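(* Let $M$ be a compact toric surface with Delzant polytope $\Delta$, $\vartheta$ a vertex of $\Delta$, $0\in\Omega\subset\mathbb C^2_\vartheta$ (the chart $\mathsf U_\vartheta\cong\mathbb C^2$ at $\vartheta$), and let $f=f_\vartheta$ be the potential function on $\Omega$ of a $\mathbb T^2$-invariant Kähler form arising from some $u\in\mathcal C^\infty(\Delta,v)$. Let $K=\mathcal S(f)\circ\tau_f^{-1}$ be the scalar curvature function viewed as a function of $\xi$. Suppose that $$\max_{\tau_f(\bar\Omega)}\Big(|K|+\sum_i\Big|\frac{\partial K}{\partial\xi_i}\Big|\Big)\le N_2,\qquad\max_{\bar\Omega}W\le N_2,\qquad\max_{\bar\Omega}|z|\le N_2$$ for some constant $N_2>0$. Put $T=\sum_if^{i\bar i}$, $P=\exp(\kappa W^\alpha)\sqrt W\,\Psi$ and $Q=e^{N_1(|z|^2-A)}\sqrt W\,T$. Then with the choice $$A=N_2^2+1,\qquad N_1=100,\qquad\alpha=\tfrac13,\qquad\kappa=\big[4N_2^{1/3}\big]^{-1}$$ one has $$\square(P+Q+C_7f)\ge C_8(P+Q)^2>0$$ on $\Omega$, for some positive constants $C_7$ and $C_8$ that depend only on $N_2$ and $n=2$.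
   Context: $\Delta=\{\xi\in\mathbb R^2:l_i(\xi)>0\}$ is an open bounded Delzant polytope, $l_i(\xi)=\langle\xi,\nu_i\rangle-\lambda_i$, $\nu_i$ primitive inward normals; $v=\sum l_i\log l_i$; $\mathcal C^\infty(\Delta,v)=\{u=v+\psi\text{ strictly convex}:\psi\in C^\infty(\bar\Delta)\}$. After a lattice-affine change of coordinates moving $\vartheta$ to the origin and the two edges at $\vartheta$ to $\{\xi_1=0\}$, $\{\xi_2=0\}$ (inward normals $(1,0)$, $(0,1)$), let $f(x)=x\cdot\xi-u(\xi)$, $x=\nabla u(\xi)$, be the Legendre transform; $f_\vartheta(z_1,z_2)=f(\log|z_1|^2,\log|z_2|^2)$ extends smoothly to $\mathbb C^2$ and is a Kähler potential. The moment map is $\tau_f(z)=\nabla f(\log|z_1|^2,\log|z_2|^2)$ (extended continuously). Since $\mathcal S(f)$ is torus invariant, $K=\mathcal S(f)\circ\tau_f^{-1}$ is a well-defined function of $\xi$. Notation: $f_{i\bar j}=\partial^2f/\partial z_i\partial\bar z_j$, $(f^{i\bar j})$ its inverse, $\square=\sum f^{i\bar j}\partial^2/\partial z_i\partial\bar z_j$, $W=\det(f_{i\bar j})$, $V=\log W$, $\Psi=\sum f^{i\bar j}V_iV_{\bar j}$, $\mathcal S(f)=-\square V$, $|z|^2=|z_1|^2+|z_2|^2$. *)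

theory Defs
  imports "HOL-Analysis.Analysis"
begin

text \<open>Both notions are meant for open \<open>S\<close>.\<close>

primrec Ck_on :: "nat \<Rightarrow> ('a::euclidean_space \<Rightarrow> real) \<Rightarrow> 'a set \<Rightarrow> bool" where
  "Ck_on 0 f S \<longleftrightarrow> continuous_on S f"
| "Ck_on (Suc k) f S \<longleftrightarrow>
     f differentiable_on S \<and> (\<forall>b\<in>Basis. Ck_on k (\<lambda>x. frechet_derivative f (at x) b) S)"

definition smooth_on :: "('a::euclidean_space \<Rightarrow> real) \<Rightarrow> 'a set \<Rightarrow> bool" where
  "smooth_on f S \<longleftrightarrow> (\<forall>k. Ck_on k f S)"

definition smooth_up_to_boundary :: "('a::euclidean_space \<Rightarrow> real) \<Rightarrow> 'a set \<Rightarrow> bool" where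
  "smooth_up_to_boundary f S \<longleftrightarrow> (\<exists>U. open U \<and> closure S \<subseteq> U \<and> smooth_on f U)"

definition strictly_convex_on :: "'a::real_vector set \<Rightarrow> ('a \<Rightarrow> real) \<Rightarrow> bool" where
  "strictly_convex_on S f \<longleftrightarrow> convex S \<and>
     (\<forall>x\<in>S. \<forall>y\<in>S. \<forall>t. x \<noteq> y \<longrightarrow> 0 < t \<longrightarrow> t < 1 \<longrightarrow>
        f ((1 - t) *\<^sub>R x + t *\<^sub>R y) < (1 - t) * f x + t * f y)"

definition grad :: "('a::real_inner \<Rightarrow> real) \<Rightarrow> 'a \<Rightarrow> 'a" where
  "grad f x = (THE D. GDERIV f x :> D)"

text \<open>The partial derivative relative to \<open>S\<close>; at points of \<open>S\<close> that are not interior it is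
  one-sided.\<close>

definition partial_within :: "(real ^ 2) set \<Rightarrow> 2 \<Rightarrow> (real ^ 2 \<Rightarrow> real) \<Rightarrow> real ^ 2 \<Rightarrow> real" where
  "partial_within S i K \<xi> = frechet_derivative K (at \<xi> within S) (axis i 1)"

definition dz :: "2 \<Rightarrow> (complex ^ 2 \<Rightarrow> complex) \<Rightarrow> complex ^ 2 \<Rightarrow> complex" where
  "dz i g z = (frechet_derivative g (at z) (axis i 1)
               - \<i> * frechet_derivative g (at z) (axis i \<i>)) / 2"

definition dzbar :: "2 \<Rightarrow> (complex ^ 2 \<Rightarrow> complex) \<Rightarrow> complex ^ 2 \<Rightarrow> complex" where
  "dzbar i g z = (frechet_derivative g (at z) (axis i 1)
                  + \<i> * frechet_derivative g (at z) (axis i \<i>)) / 2"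

text \<open>A polygon is given by the number \<open>d\<close> of its edges, the integral inward normals
  \<open>\<nu> i\<close> and the constants \<open>lam i\<close>, for \<open>i < d\<close>.\<close>

definition edge_fun :: "(nat \<Rightarrow> int ^ 2) \<Rightarrow> (nat \<Rightarrow> real) \<Rightarrow> nat \<Rightarrow> real ^ 2 \<Rightarrow> real" where
  "edge_fun \<nu> lam i \<xi> = \<xi> \<bullet> (\<chi> j. real_of_int (\<nu> i $ j)) - lam i"

definition open_polygon :: "nat \<Rightarrow> (nat \<Rightarrow> int ^ 2) \<Rightarrow> (nat \<Rightarrow> real) \<Rightarrow> (real ^ 2) set" where
  "open_polygon d \<nu> lam = {\<xi>. \<forall>i<d. edge_fun \<nu> lam i \<xi> > 0}"

definition edge :: "nat \<Rightarrow> (nat \<Rightarrow> int ^ 2) \<Rightarrow> (nat \<Rightarrow> real) \<Rightarrow> nat \<Rightarrow> (real ^ 2) set" where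
  "edge d \<nu> lam i = {\<xi> \<in> closure (open_polygon d \<nu> lam). edge_fun \<nu> lam i \<xi> = 0}"

definition lattice_basis :: "int ^ 2 \<Rightarrow> int ^ 2 \<Rightarrow> bool" where
  "lattice_basis p q \<longleftrightarrow> (\<forall>w. \<exists>!ab. w = fst ab *s p + snd ab *s q)"

text \<open>The indices below \<open>d\<close> enumerate the edges without redundancy or repetition, so that
  \<open>guillemin_potential\<close> has exactly one summand for each edge.\<close>

definition delzant :: "nat \<Rightarrow> (nat \<Rightarrow> int ^ 2) \<Rightarrow> (nat \<Rightarrow> real) \<Rightarrow> bool" where
  "delzant d \<nu> lam \<longleftrightarrow>
     open_polygon d \<nu> lam \<noteq> {} \<and> bounded (open_polygon d \<nu> lam) \<and>
     (\<forall>i<d. coprime (\<nu> i $ 1) (\<nu> i $ 2)) \<and>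
     (\<forall>i<d. edge d \<nu> lam i facet_of closure (open_polygon d \<nu> lam)) \<and>
     inj_on (edge d \<nu> lam) {..<d} \<and>
     (\<forall>p. p extreme_point_of closure (open_polygon d \<nu> lam) \<longrightarrow>
        (\<exists>i<d. \<exists>j<d. i \<noteq> j \<and> {k. k < d \<and> p \<in> edge d \<nu> lam k} = {i, j} \<and>
           lattice_basis (\<nu> i) (\<nu> j)))"

definition guillemin_potential :: "nat \<Rightarrow> (nat \<Rightarrow> int ^ 2) \<Rightarrow> (nat \<Rightarrow> real) \<Rightarrow> real ^ 2 \<Rightarrow> real" where
  "guillemin_potential d \<nu> lam \<xi> = (\<Sum>i<d. edge_fun \<nu> lam i \<xi> * ln (edge_fun \<nu> lam i \<xi>))"

text \<open>The class \<open>C\<^sup>\<infinity>(\<Delta>, v)\<close>; only the values on the open polygon matter.\<close>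

definition symplectic_potentials ::
    "nat \<Rightarrow> (nat \<Rightarrow> int ^ 2) \<Rightarrow> (nat \<Rightarrow> real) \<Rightarrow> (real ^ 2 \<Rightarrow> real) set" where
  "symplectic_potentials d \<nu> lam =
     {u. strictly_convex_on (open_polygon d \<nu> lam) u \<and>
         (\<exists>\<psi>. smooth_up_to_boundary \<psi> (open_polygon d \<nu> lam) \<and>
              (\<forall>\<xi>\<in>open_polygon d \<nu> lam. u \<xi> = guillemin_potential d \<nu> lam \<xi> + \<psi> \<xi>))}"

text \<open>\<open>invertible\<close> is over the integers, so the linear part lies in \<open>GL(2, \<int>)\<close>.\<close>

definition lattice_affine :: "(real ^ 2 \<Rightarrow> real ^ 2) \<Rightarrow> bool" where
  "lattice_affine \<phi> \<longleftrightarrow>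
     (\<exists>(B :: int ^ 2 ^ 2) b. invertible B \<and>
        (\<forall>\<xi>. \<phi> \<xi> = (\<chi> i j. real_of_int (B $ i $ j)) *v \<xi> + b))"

text \<open>The last condition says that in the coordinates \<open>\<phi> \<xi>\<close> the defining functions of two
  edges through \<open>p\<close> are the coordinate functions: these edges lie on the coordinate
  axes and have inward normals \<open>(1,0)\<close> and \<open>(0,1)\<close>.\<close>

definition adapted_coordinates ::
    "nat \<Rightarrow> (nat \<Rightarrow> int ^ 2) \<Rightarrow> (nat \<Rightarrow> real) \<Rightarrow> real ^ 2 \<Rightarrow> (real ^ 2 \<Rightarrow> real ^ 2) \<Rightarrow> bool" where
  "adapted_coordinates d \<nu> lam p \<phi> \<longleftrightarrow> lattice_affine \<phi> \<and> \<phi> p = 0 \<and>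
     (\<exists>i<d. \<exists>j<d. i \<noteq> j \<and> p \<in> edge d \<nu> lam i \<and> p \<in> edge d \<nu> lam j \<and>
        (\<forall>\<xi>. edge_fun \<nu> lam i \<xi> = \<phi> \<xi> $ 1 \<and> edge_fun \<nu> lam j \<xi> = \<phi> \<xi> $ 2))"

definition legendre :: "(real ^ 2) set \<Rightarrow> (real ^ 2 \<Rightarrow> real) \<Rightarrow> real ^ 2 \<Rightarrow> real" where
  "legendre D u x = (let \<xi> = inv_into D (grad u) x in x \<bullet> \<xi> - u \<xi>)"

definition ctorus :: "(complex ^ 2) set" where
  "ctorus = {z. z $ 1 \<noteq> 0 \<and> z $ 2 \<noteq> 0}"

definition log_coords :: "complex ^ 2 \<Rightarrow> real ^ 2" where
  "log_coords z = (\<chi> i. ln ((cmod (z $ i))\<^sup>2))"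

text \<open>Continuous extension of \<open>\<nabla>f(log |z\<^sub>1|\<^sup>2, log |z\<^sub>2|\<^sup>2)\<close> from the torus.\<close>

definition moment_map :: "(real ^ 2 \<Rightarrow> real) \<Rightarrow> complex ^ 2 \<Rightarrow> real ^ 2" where
  "moment_map f z = Lim (at z within ctorus) (\<lambda>w. grad f (log_coords w))"

definition hess :: "(complex ^ 2 \<Rightarrow> real) \<Rightarrow> complex ^ 2 \<Rightarrow> complex ^ 2 ^ 2" where
  "hess g z = (\<chi> i j. dz i (dzbar j (\<lambda>w. complex_of_real (g w))) z)"

text \<open>The matrix \<open>hess F z\<close> is Hermitian, so its determinant and the other sums below whose
  real part is taken are real.\<close>

definition kahler_potential :: "(complex ^ 2 \<Rightarrow> real) \<Rightarrow> bool" where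
  "kahler_potential F \<longleftrightarrow> smooth_on F UNIV \<and>
     (\<forall>z w. w \<noteq> 0 \<longrightarrow> Re (\<Sum>i\<in>UNIV. \<Sum>j\<in>UNIV. hess F z $ i $ j * w $ i * cnj (w $ j)) > 0)"

text \<open>\<open>F\<close> is the smooth extension \<open>f\<^sub>\<theta>\<close> of \<open>f(log |z\<^sub>1|\<^sup>2, log |z\<^sub>2|\<^sup>2)\<close> to \<open>\<complex>\<^sup>2\<close>; it is unique
  since the torus is dense.\<close>

definition chart_potential :: "(real ^ 2 \<Rightarrow> real) \<Rightarrow> (complex ^ 2 \<Rightarrow> real) \<Rightarrow> bool" where
  "chart_potential f F \<longleftrightarrow> kahler_potential F \<and> (\<forall>z\<in>ctorus. F z = f (log_coords z))"

text \<open>\<open>f\<^sup>i\<^sup>j\<close> is normalised by \<open>\<Sum>\<^sub>j f\<^sup>i\<^sup>j f\<^sub>k\<^sub>j = \<delta>\<^sub>i\<^sub>k\<close>, where the second index is the barred one; hence the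
  transposition.\<close>

definition inv_hess :: "(complex ^ 2 \<Rightarrow> real) \<Rightarrow> complex ^ 2 \<Rightarrow> complex ^ 2 ^ 2" where
  "inv_hess F z = transpose (matrix_inv (hess F z))"

definition Box :: "(complex ^ 2 \<Rightarrow> real) \<Rightarrow> (complex ^ 2 \<Rightarrow> real) \<Rightarrow> complex ^ 2 \<Rightarrow> real" where
  "Box F g z = Re (\<Sum>i\<in>UNIV. \<Sum>j\<in>UNIV. inv_hess F z $ i $ j * hess g z $ i $ j)"

definition detW :: "(complex ^ 2 \<Rightarrow> real) \<Rightarrow> complex ^ 2 \<Rightarrow> real" where
  "detW F z = Re (det (hess F z))"

definition logV :: "(complex ^ 2 \<Rightarrow> real) \<Rightarrow> complex ^ 2 \<Rightarrow> real" where
  "logV F z = ln (detW F z)"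

definition Psi :: "(complex ^ 2 \<Rightarrow> real) \<Rightarrow> complex ^ 2 \<Rightarrow> real" where
  "Psi F z = Re (\<Sum>i\<in>UNIV. \<Sum>j\<in>UNIV. inv_hess F z $ i $ j *
     dz i (\<lambda>w. complex_of_real (logV F w)) z * dzbar j (\<lambda>w. complex_of_real (logV F w)) z)"

definition scalar_curvature :: "(complex ^ 2 \<Rightarrow> real) \<Rightarrow> complex ^ 2 \<Rightarrow> real" where
  "scalar_curvature F z = - Box F (logV F) z"

definition trT :: "(complex ^ 2 \<Rightarrow> real) \<Rightarrow> complex ^ 2 \<Rightarrow> real" where
  "trT F z = Re (\<Sum>i\<in>UNIV. inv_hess F z $ i $ i)"

definition P_fun :: "real \<Rightarrow> real \<Rightarrow> (complex ^ 2 \<Rightarrow> real) \<Rightarrow> complex ^ 2 \<Rightarrow> real" where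
  "P_fun \<kappa> \<alpha> F z = exp (\<kappa> * detW F z powr \<alpha>) * sqrt (detW F z) * Psi F z"

definition Q_fun :: "real \<Rightarrow> real \<Rightarrow> (complex ^ 2 \<Rightarrow> real) \<Rightarrow> complex ^ 2 \<Rightarrow> real" where
  "Q_fun N1 A F z = exp (N1 * ((norm z)\<^sup>2 - A)) * sqrt (detW F z) * trT F z"

text \<open>\<open>K = S(f) \<circ> \<tau>\<^sub>f\<^sup>-\<^sup>1\<close>, a function on the range of \<open>\<tau>\<close>; by torus invariance it does not depend
  on the preimage chosen by \<open>inv\<close>.\<close>

definition curvature_xi ::
    "(complex ^ 2 \<Rightarrow> real ^ 2) \<Rightarrow> (complex ^ 2 \<Rightarrow> real) \<Rightarrow> real ^ 2 \<Rightarrow> real" where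
  "curvature_xi \<tau> F = scalar_curvature F \<circ> inv \<tau>"

end

theory Submission
  imports Defs
begin

text \<open>
  For a field \<open>a = (a\<^sub>1, a\<^sub>2)\<close> of \<open>(1,0)\<close>-forms and a real function \<open>g\<close>, the Bochner formula gives
  \<open>\<box>(e\<^sup>g |a|\<^sup>2) = e\<^sup>g (|\<nabla>a + \<partial>g \<otimes> a|\<^sup>2 + |\<partial>bar a|\<^sup>2 + 2 Re \<langle>tr (\<nabla> + \<partial>g) \<partial>bar a, a\<rangle> + (\<box>g) |a|\<^sup>2 - \<langle>\<partial>\<partial>bar V, a \<otimes> abar\<rangle>)\<close>.
  The first square is discarded. With \<open>a = \<partial>V\<close> and \<open>g = \<kappa> W\<^sup>\<alpha> + V/2\<close> this bounds \<open>\<box>P\<close>; with \<open>a = dz\<^sub>1, dz\<^sub>2\<close>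
  and \<open>g = N\<^sub>1 (|z|\<^sup>2 - A) + V/2\<close> it bounds \<open>\<box>Q\<close>. Completing squares with the Ricci tensor \<open>\<partial>\<partial>bar V\<close>, a
  multiple of \<open>|\<partial>\<partial>bar V|\<^sup>2\<close> from \<open>\<box>P\<close> absorbs the Ricci term of \<open>\<box>Q\<close>. The remaining term \<open>\<langle>\<partial>S, \<partial>V\<rangle>\<close> is
  controlled because \<open>S = K \<circ> \<tau>\<close> and \<open>\<partial>\<^sub>k \<tau>\<^sub>i = zbar\<^sub>i f\<^sub>k\<^sub>ibar\<close>, so that it equals \<open>\<Sum> K\<^sub>i zbar\<^sub>i V\<^sub>ibar\<close>. All of this is done
  on the dense torus \<open>z\<^sub>1 z\<^sub>2 \<noteq> 0\<close>; both sides of the estimate are continuous.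
\<close>

subsection \<open>Wirtinger calculus\<close>

text \<open>The factor sqrt W has two roles. In P it adds V/2 to the twist g, and the cross term
  this produces cancels the Ricci term exactly; what is left carries the factor 2 \<kappa> \<alpha>
  W^\<alpha>, which is small since \<kappa> W^\<alpha> \<le> 1/4. Equal powers of W in P and Q,
  together with e^{N1 (|z|^2 - A)} \<le> 1 \<le> exp(\<kappa> W^\<alpha>), let |ddbar V|^2 from P
  pay for the Ricci term of Q; this is why A exceeds |z|^2. The good terms are \<kappa> \<alpha>^2
  W^\<alpha> \<Psi>^2 and N1 T^2; they dominate P^2 and Q^2 because W is bounded above and \<alpha>
  \<le> 1/2. All other terms are at most linear in P + Q: the gradient pairing has size sqrt(W
  \<Psi> T), hence that of sqrt(P Q). Completing the square costs a constant, which C7 f repays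
  because the Laplacian of f is 2. The torus is forced by K: on the axes the differential of \<tau>
  drops rank, whereas over the torus the gradient of f is an open embedding with invertible
  derivative, so that K is differentiable and the chain rule applies.\<close>

lemma dz_eq:
  assumes "(g has_derivative g') (at z)"
  shows "dz i g z = (g' (axis i 1) - \<i> * g' (axis i \<i>)) / 2"
  unfolding dz_def using frechet_derivative_at[OF assms] by simp

lemma dzbar_eq:
  assumes "(g has_derivative g') (at z)"
  shows "dzbar i g z = (g' (axis i 1) + \<i> * g' (axis i \<i>)) / 2"
  unfolding dzbar_def using frechet_derivative_at[OF assms] by simp

lemma frechet_axis_one: "frechet_derivative g (at z) (axis i 1) = dz i g z + dzbar i g z"
  by (simp add: dz_def dzbar_def field_simps)

lemma frechet_axis_ii: "frechet_derivative g (at z) (axis i \<i>) = \<i> * (dz i g z - dzbar i g z)"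
  by (simp add: dz_def dzbar_def field_simps)

text \<open>Phrased with \<open>dz\<close> and \<open>dzbar\<close> and on the whole space:
  derivative rules become equations between functions, which can be rewritten under further
  derivatives, and closure properties follow by induction on the order.\<close>

primrec Ck_complex :: "nat \<Rightarrow> (complex ^ 2 \<Rightarrow> complex) \<Rightarrow> bool" where
  "Ck_complex 0 g \<longleftrightarrow> continuous_on UNIV g"
| "Ck_complex (Suc k) g \<longleftrightarrow>
     (\<forall>z. g differentiable (at z)) \<and> (\<forall>i. Ck_complex k (dz i g) \<and> Ck_complex k (dzbar i g))"

definition smooth_complex :: "(complex ^ 2 \<Rightarrow> complex) \<Rightarrow> bool" where
  "smooth_complex g \<longleftrightarrow> (\<forall>k. Ck_complex k g)"

lemma Ck_complex_SucD: "Ck_complex (Suc k) g \<Longrightarrow> Ck_complex k g"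
proof (induction k arbitrary: g)
  case 0
  then show ?case
    by (auto intro!: differentiable_imp_continuous_on simp: differentiable_on_def)
next
  case (Suc k)
  have "\<forall>z. g differentiable (at z)" "Ck_complex (Suc k) (dz i g)" "Ck_complex (Suc k) (dzbar i g)" for i
    using Suc.prems Ck_complex.simps(2)[of "Suc k" g] by blast+
  then show ?case using Suc.IH Ck_complex.simps(2)[of k g] by blast
qed

lemma smooth_differentiable: "smooth_complex g \<Longrightarrow> g differentiable (at z)"
  unfolding smooth_complex_def by (metis Ck_complex.simps(2))

lemma smooth_has_derivative:
  "smooth_complex g \<Longrightarrow> (g has_derivative frechet_derivative g (at z)) (at z)"
  using smooth_differentiable frechet_derivative_works by blast

lemma smooth_continuous: "smooth_complex g \<Longrightarrow> continuous_on UNIV g"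
  unfolding smooth_complex_def by (metis Ck_complex.simps(1))

lemma smooth_dz: "smooth_complex g \<Longrightarrow> smooth_complex (dz i g)"
  and smooth_dzbar: "smooth_complex g \<Longrightarrow> smooth_complex (dzbar i g)"
  unfolding smooth_complex_def by (metis Ck_complex.simps(2))+

lemma smoothI:
  assumes "\<And>z. g differentiable (at z)" "\<And>i. smooth_complex (dz i g)" "\<And>i. smooth_complex (dzbar i g)"
  shows "smooth_complex g"
  unfolding smooth_complex_def
proof
  fix k
  show "Ck_complex k g"
    by (rule Ck_complex_SucD) (use assms in \<open>auto simp: smooth_complex_def\<close>)
qed

lemma dz_const [simp]: "dz i (\<lambda>w. c) = (\<lambda>w. 0)" and dzbar_const [simp]: "dzbar i (\<lambda>w. c) = (\<lambda>w. 0)"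
  by (auto simp: dz_def dzbar_def)

lemma Ck_complex_const: "Ck_complex k (\<lambda>w. c)"
  by (induction k arbitrary: c) auto

lemma smooth_const [simp]: "smooth_complex (\<lambda>w. c)"
  by (simp add: smooth_complex_def Ck_complex_const)

lemma
  assumes "\<And>z. f differentiable (at z)" "\<And>z. g differentiable (at z)"
  shows dz_add': "dz i (\<lambda>w. f w + g w) = (\<lambda>w. dz i f w + dz i g w)"
    and dzbar_add': "dzbar i (\<lambda>w. f w + g w) = (\<lambda>w. dzbar i f w + dzbar i g w)"
    and dz_mult': "dz i (\<lambda>w. f w * g w) = (\<lambda>w. dz i f w * g w + f w * dz i g w)"
    and dzbar_mult': "dzbar i (\<lambda>w. f w * g w) = (\<lambda>w. dzbar i f w * g w + f w * dzbar i g w)"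
proof -
  have f: "(f has_derivative frechet_derivative f (at z)) (at z)"
    and g: "(g has_derivative frechet_derivative g (at z)) (at z)" for z
    using assms frechet_derivative_works by blast+
  show "dz i (\<lambda>w. f w + g w) = (\<lambda>w. dz i f w + dz i g w)"
    unfolding fun_eq_iff dz_eq[OF has_derivative_add[OF f g]] by (simp add: dz_def field_simps)
  show "dzbar i (\<lambda>w. f w + g w) = (\<lambda>w. dzbar i f w + dzbar i g w)"
    unfolding fun_eq_iff dzbar_eq[OF has_derivative_add[OF f g]] by (simp add: dzbar_def field_simps)
  show "dz i (\<lambda>w. f w * g w) = (\<lambda>w. dz i f w * g w + f w * dz i g w)"
    unfolding fun_eq_iff dz_eq[OF has_derivative_mult[OF f g]] by (simp add: dz_def field_simps)
  show "dzbar i (\<lambda>w. f w * g w) = (\<lambda>w. dzbar i f w * g w + f w * dzbar i g w)"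
    unfolding fun_eq_iff dzbar_eq[OF has_derivative_mult[OF f g]] by (simp add: dzbar_def field_simps)
qed

lemma Ck_complex_add: "Ck_complex k f \<Longrightarrow> Ck_complex k g \<Longrightarrow> Ck_complex k (\<lambda>w. f w + g w)"
  by (induction k arbitrary: f g) (auto intro: continuous_intros simp: dz_add' dzbar_add')

lemma Ck_complex_mult: "Ck_complex k f \<Longrightarrow> Ck_complex k g \<Longrightarrow> Ck_complex k (\<lambda>w. f w * g w)"
proof (induction k arbitrary: f g)
  case 0
  then show ?case by (auto intro: continuous_intros)
next
  case (Suc k)
  then have "Ck_complex k f" "Ck_complex k g" using Ck_complex_SucD by blast+
  then have "Ck_complex k (\<lambda>w. dz i f w * g w + f w * dz i g w)"
    "Ck_complex k (\<lambda>w. dzbar i f w * g w + f w * dzbar i g w)" for i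
    using Suc.prems by (intro Ck_complex_add Suc.IH; simp)+
  with Suc.prems show ?case
    by (simp add: dz_mult' dzbar_mult' differentiable_mult)
qed

lemma smooth_add [intro]: "smooth_complex f \<Longrightarrow> smooth_complex g \<Longrightarrow> smooth_complex (\<lambda>w. f w + g w)"
  by (simp add: smooth_complex_def Ck_complex_add)

lemma smooth_mult [intro]: "smooth_complex f \<Longrightarrow> smooth_complex g \<Longrightarrow> smooth_complex (\<lambda>w. f w * g w)"
  by (simp add: smooth_complex_def Ck_complex_mult)

lemma dz_add: "smooth_complex f \<Longrightarrow> smooth_complex g \<Longrightarrow> dz i (\<lambda>w. f w + g w) = (\<lambda>w. dz i f w + dz i g w)"
  and dzbar_add: "smooth_complex f \<Longrightarrow> smooth_complex g \<Longrightarrow> dzbar i (\<lambda>w. f w + g w) = (\<lambda>w. dzbar i f w + dzbar i g w)"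
  and dz_mult: "smooth_complex f \<Longrightarrow> smooth_complex g \<Longrightarrow> dz i (\<lambda>w. f w * g w) = (\<lambda>w. dz i f w * g w + f w * dz i g w)"
  and dzbar_mult: "smooth_complex f \<Longrightarrow> smooth_complex g \<Longrightarrow> dzbar i (\<lambda>w. f w * g w) = (\<lambda>w. dzbar i f w * g w + f w * dzbar i g w)"
  by (intro dz_add' dzbar_add' dz_mult' dzbar_mult' smooth_differentiable; assumption)+

lemma smooth_uminus [intro]: "smooth_complex f \<Longrightarrow> smooth_complex (\<lambda>w. - f w)"
  using smooth_mult[OF smooth_const[of "-1"]] by simp

lemma smooth_diff [intro]: "smooth_complex f \<Longrightarrow> smooth_complex g \<Longrightarrow> smooth_complex (\<lambda>w. f w - g w)"
  using smooth_add[OF _ smooth_uminus] by fastforce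

lemma smooth_divide_const [intro]: "smooth_complex f \<Longrightarrow> smooth_complex (\<lambda>w. f w / c)"
  using smooth_mult[OF _ smooth_const[of "inverse c"]] by (simp add: field_class.field_divide_inverse)

lemma dz_uminus: "smooth_complex f \<Longrightarrow> dz i (\<lambda>w. - f w) = (\<lambda>w. - dz i f w)"
  and dzbar_uminus: "smooth_complex f \<Longrightarrow> dzbar i (\<lambda>w. - f w) = (\<lambda>w. - dzbar i f w)"
  using dz_mult[OF smooth_const[of "-1"]] dzbar_mult[OF smooth_const[of "-1"]] by simp_all

lemma dz_diff: "smooth_complex f \<Longrightarrow> smooth_complex g \<Longrightarrow> dz i (\<lambda>w. f w - g w) = (\<lambda>w. dz i f w - dz i g w)"
  and dzbar_diff: "smooth_complex f \<Longrightarrow> smooth_complex g \<Longrightarrow> dzbar i (\<lambda>w. f w - g w) = (\<lambda>w. dzbar i f w - dzbar i g w)"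
  using dz_add[OF _ smooth_uminus] dzbar_add[OF _ smooth_uminus] dz_uminus dzbar_uminus
  by fastforce+

lemma smooth_sum [intro]: "(\<And>i. i \<in> I \<Longrightarrow> smooth_complex (f i)) \<Longrightarrow> smooth_complex (\<lambda>w. \<Sum>i\<in>I. f i w)"
  by (induction I rule: infinite_finite_induct) auto

lemma dz_sum: "(\<And>i. i \<in> I \<Longrightarrow> smooth_complex (f i)) \<Longrightarrow> dz k (\<lambda>w. \<Sum>i\<in>I. f i w) = (\<lambda>w. \<Sum>i\<in>I. dz k (f i) w)"
  and dzbar_sum: "(\<And>i. i \<in> I \<Longrightarrow> smooth_complex (f i)) \<Longrightarrow> dzbar k (\<lambda>w. \<Sum>i\<in>I. f i w) = (\<lambda>w. \<Sum>i\<in>I. dzbar k (f i) w)"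
  by (induction I rule: infinite_finite_induct) (auto simp: dz_add dzbar_add smooth_sum)

lemma
  assumes "\<And>z. f differentiable (at z)" "\<And>z. f z \<noteq> 0"
  shows differentiable_inverse_c: "(\<lambda>w. inverse (f w)) differentiable (at z)"
    and dz_inverse': "dz i (\<lambda>w. inverse (f w)) = (\<lambda>w. - dz i f w * (inverse (f w) * inverse (f w)))"
    and dzbar_inverse': "dzbar i (\<lambda>w. inverse (f w)) = (\<lambda>w. - dzbar i f w * (inverse (f w) * inverse (f w)))"
proof -
  have f: "(f has_derivative frechet_derivative f (at z)) (at z)" for z
    using assms frechet_derivative_works by blast
  show "(\<lambda>w. inverse (f w)) differentiable (at z)"
    using Deriv.has_derivative_inverse[OF assms(2) f] differentiable_def by blast
  show "dz i (\<lambda>w. inverse (f w)) = (\<lambda>w. - dz i f w * (inverse (f w) * inverse (f w)))"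
    unfolding fun_eq_iff dz_eq[OF Deriv.has_derivative_inverse[OF assms(2) f]] using assms(2) by (simp add: dz_def field_simps)
  show "dzbar i (\<lambda>w. inverse (f w)) = (\<lambda>w. - dzbar i f w * (inverse (f w) * inverse (f w)))"
    unfolding fun_eq_iff dzbar_eq[OF Deriv.has_derivative_inverse[OF assms(2) f]] using assms(2) by (simp add: dzbar_def field_simps)
qed

text \<open>The derivative of the reciprocal is a smooth factor times two copies of the reciprocal,
  so order k of the reciprocal yields order k + 1. The same bootstrapping serves
  \<open>smooth_exp\<close>.\<close>

lemma smooth_inverse:
  assumes "smooth_complex f" "\<And>z. f z \<noteq> 0"
  shows "smooth_complex (\<lambda>w. inverse (f w))"
  unfolding smooth_complex_def
proof
  fix k show "Ck_complex k (\<lambda>w. inverse (f w))"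
  proof (induction k)
    case 0
    then show ?case using assms smooth_continuous by (auto intro!: continuous_intros)
  next
    case (Suc k)
    have "Ck_complex k (\<lambda>w. - dz i f w)" "Ck_complex k (\<lambda>w. - dzbar i f w)" for i
      using smooth_uminus[OF smooth_dz[OF assms(1)]] smooth_uminus[OF smooth_dzbar[OF assms(1)]]
      by (auto simp: smooth_complex_def)
    from this[THEN Ck_complex_mult, OF Ck_complex_mult, OF Suc Suc] show ?case
      using assms smooth_differentiable
      by (simp add: dz_inverse' dzbar_inverse' differentiable_inverse_c)
  qed
qed

lemma
  assumes "\<And>z. f differentiable (at z)"
  shows differentiable_exp_c: "(\<lambda>w. exp (f w :: complex)) differentiable (at z)"
    and dz_exp': "dz i (\<lambda>w. exp (f w)) = (\<lambda>w. exp (f w) * dz i f w)"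
    and dzbar_exp': "dzbar i (\<lambda>w. exp (f w)) = (\<lambda>w. exp (f w) * dzbar i f w)"
proof -
  have f: "(f has_derivative frechet_derivative f (at z)) (at z)" for z
    using assms frechet_derivative_works by blast
  have e: "((\<lambda>w. exp (f w)) has_derivative (\<lambda>h. exp (f z) * frechet_derivative f (at z) h)) (at z)" for z
    using field_vector_diff_chain_at has_derivative_compose[OF f DERIV_exp[unfolded has_field_derivative_def]] by auto
  then show "(\<lambda>w. exp (f w)) differentiable (at z)" using differentiable_def by blast
  show "dz i (\<lambda>w. exp (f w)) = (\<lambda>w. exp (f w) * dz i f w)"
    unfolding fun_eq_iff dz_eq[OF e] by (simp add: dz_def field_simps)
  show "dzbar i (\<lambda>w. exp (f w)) = (\<lambda>w. exp (f w) * dzbar i f w)"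
    unfolding fun_eq_iff dzbar_eq[OF e] by (simp add: dzbar_def field_simps)
qed

lemma smooth_exp:
  assumes "smooth_complex f"
  shows "smooth_complex (\<lambda>w. exp (f w))"
  unfolding smooth_complex_def
proof
  fix k show "Ck_complex k (\<lambda>w. exp (f w))"
  proof (induction k)
    case 0
    then show ?case using assms smooth_continuous by (auto intro!: continuous_intros)
  next
    case (Suc k)
    have "Ck_complex k (dz i f)" "Ck_complex k (dzbar i f)" for i
      using smooth_dz[OF assms(1)] smooth_dzbar[OF assms(1)] by (auto simp: smooth_complex_def)
    then show ?case
      using Suc assms smooth_differentiable
      by (auto simp: dz_exp' dzbar_exp' differentiable_exp_c intro!: Ck_complex_mult)
  qed
qed

lemma dz_exp: "smooth_complex f \<Longrightarrow> dz i (\<lambda>w. exp (f w)) = (\<lambda>w. exp (f w) * dz i f w)"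
  and dzbar_exp: "smooth_complex f \<Longrightarrow> dzbar i (\<lambda>w. exp (f w)) = (\<lambda>w. exp (f w) * dzbar i f w)"
  by (intro dz_exp' dzbar_exp' smooth_differentiable; assumption)+

lemma
  assumes "\<And>z. f differentiable (at z)"
  shows differentiable_cnj: "(\<lambda>w. cnj (f w)) differentiable (at z)"
    and dz_cnj': "dz i (\<lambda>w. cnj (f w)) = (\<lambda>w. cnj (dzbar i f w))"
    and dzbar_cnj': "dzbar i (\<lambda>w. cnj (f w)) = (\<lambda>w. cnj (dz i f w))"
proof -
  have f: "(f has_derivative frechet_derivative f (at z)) (at z)" for z
    using assms frechet_derivative_works by blast
  have e: "((\<lambda>w. cnj (f w)) has_derivative (\<lambda>h. cnj (frechet_derivative f (at z) h))) (at z)" for z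
    using f has_derivative_cnj by blast
  then show "(\<lambda>w. cnj (f w)) differentiable (at z)" using differentiable_def by blast
  show "dz i (\<lambda>w. cnj (f w)) = (\<lambda>w. cnj (dzbar i f w))"
    unfolding fun_eq_iff dz_eq[OF e] by (simp add: dzbar_def field_simps)
  show "dzbar i (\<lambda>w. cnj (f w)) = (\<lambda>w. cnj (dz i f w))"
    unfolding fun_eq_iff dzbar_eq[OF e] by (simp add: dz_def field_simps)
qed

lemma Ck_complex_cnj: "Ck_complex k f \<Longrightarrow> Ck_complex k (\<lambda>w. cnj (f w))"
  by (induction k arbitrary: f) (auto intro: continuous_intros simp: dz_cnj' dzbar_cnj' differentiable_cnj)

lemma smooth_cnj [intro]: "smooth_complex f \<Longrightarrow> smooth_complex (\<lambda>w. cnj (f w))"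
  by (simp add: smooth_complex_def Ck_complex_cnj)

lemma dz_cnj: "smooth_complex f \<Longrightarrow> dz i (\<lambda>w. cnj (f w)) = (\<lambda>w. cnj (dzbar i f w))"
  and dzbar_cnj: "smooth_complex f \<Longrightarrow> dzbar i (\<lambda>w. cnj (f w)) = (\<lambda>w. cnj (dz i f w))"
  by (intro dz_cnj' dzbar_cnj' smooth_differentiable; assumption)+

lemma has_derivative_nth: "((\<lambda>w::complex^2. w $ j) has_derivative (\<lambda>h. h $ j)) (at z)"
  by (rule bounded_linear_imp_has_derivative) (rule bounded_linear_vec_nth)

lemma dz_nth: "dz i (\<lambda>w. w $ j) = (\<lambda>w. if i = j then 1 else 0)"
  and dzbar_nth: "dzbar i (\<lambda>w. w $ j) = (\<lambda>w. 0)"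
  unfolding fun_eq_iff dz_eq[OF has_derivative_nth] dzbar_eq[OF has_derivative_nth] by (auto simp: axis_def)

lemma smooth_nth [simp]: "smooth_complex (\<lambda>w. w $ j)"
  by (rule smoothI) (auto simp: dz_nth dzbar_nth intro: has_derivative_nth differentiableI)

text \<open>Both mixed partials are limits of the same second-order difference quotient.\<close>

lemma mixed_difference:
  fixes f :: "'a::euclidean_space \<Rightarrow> real"
  assumes f: "\<And>z. (f has_derivative f' z) (at z)"
    and fa: "\<And>z. ((\<lambda>z. f' z a) has_derivative fa z) (at z)"
    and h: "h > 0"
  obtains s t where "0 < s" "s < h" "0 < t" "t < h"
    "f (z + h *\<^sub>R a + h *\<^sub>R b) - f (z + h *\<^sub>R a) - f (z + h *\<^sub>R b) + f z
      = h\<^sup>2 * fa (z + s *\<^sub>R a + t *\<^sub>R b) b"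
proof -
  define p where "p s = f (z + s *\<^sub>R a + h *\<^sub>R b) - f (z + s *\<^sub>R a)" for s
  have lin: "f' w (c *\<^sub>R v) = c * f' w v" "fa w (c *\<^sub>R v) = c * fa w v" for w c v
    using has_derivative_bounded_linear[OF f] has_derivative_bounded_linear[OF fa]
    by (simp_all add: linear_cmul bounded_linear.linear)
  have d1: "((\<lambda>s. f (z + s *\<^sub>R a + c)) has_real_derivative f' (z + s *\<^sub>R a + c) a) (at s)" for s c
    unfolding has_field_derivative_def
    by (rule has_derivative_eq_rhs, rule has_derivative_compose[OF _ f])
      (auto intro!: derivative_eq_intros simp: lin mult.commute)
  have "(p has_real_derivative f' (z + s *\<^sub>R a + h *\<^sub>R b) a - f' (z + s *\<^sub>R a) a) (at s)" for s
    unfolding p_def using DERIV_diff[OF d1[of "h *\<^sub>R b"] d1[of 0]] by simp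
  from MVT2[OF h, of p, OF this] obtain s where s: "0 < s" "s < h"
    "p h - p 0 = h * (f' (z + s *\<^sub>R a + h *\<^sub>R b) a - f' (z + s *\<^sub>R a) a)" by auto
  have "((\<lambda>t. f' (z + s *\<^sub>R a + t *\<^sub>R b) a) has_real_derivative fa (z + s *\<^sub>R a + t *\<^sub>R b) b) (at t)" for t
    unfolding has_field_derivative_def
    by (rule has_derivative_eq_rhs, rule has_derivative_compose[OF _ fa])
      (auto intro!: derivative_eq_intros simp: lin mult.commute)
  from MVT2[OF h, OF this] obtain t where t: "0 < t" "t < h"
    "f' (z + s *\<^sub>R a + h *\<^sub>R b) a - f' (z + s *\<^sub>R a) a = h * fa (z + s *\<^sub>R a + t *\<^sub>R b) b" by auto
  show ?thesis
    by (rule that[OF s(1,2) t(1,2)]) (use s t in \<open>auto simp: p_def power2_eq_square\<close>)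
qed

lemma second_derivative_symmetric:
  fixes f :: "'a::euclidean_space \<Rightarrow> real"
  assumes f: "\<And>z. (f has_derivative f' z) (at z)"
    and fa: "\<And>z. ((\<lambda>z. f' z a) has_derivative fa z) (at z)"
    and fb: "\<And>z. ((\<lambda>z. f' z b) has_derivative fb z) (at z)"
    and ca: "isCont (\<lambda>z. fa z b) z" and cb: "isCont (\<lambda>z. fb z a) z"
  shows "fa z b = fb z a"
proof (rule ccontr)
  assume ne: "fa z b \<noteq> fb z a"
  define e where "e = \<bar>fa z b - fb z a\<bar> / 2"
  have e: "e > 0" using ne by (simp add: e_def)
  obtain d1 where d1: "d1 > 0" "\<And>w. dist w z < d1 \<Longrightarrow> dist (fa w b) (fa z b) < e"
    using ca e by (auto simp: continuous_at_eps_delta)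
  obtain d2 where d2: "d2 > 0" "\<And>w. dist w z < d2 \<Longrightarrow> dist (fb w a) (fb z a) < e"
    using cb e by (auto simp: continuous_at_eps_delta)
  \<comment> \<open>Small enough that all points z + s a + t b with 0 < s, t < h lie within both
    continuity radii. The common difference quotient then puts the two mixed partials less than 2 e
    apart.\<close>
  define h where "h = min d1 d2 / (norm a + norm b + 1)"
  have pos: "norm a + norm b + 1 > 0" by (smt (verit) norm_ge_zero)
  have h: "h > 0" using d1 d2 pos by (simp add: h_def)
  have small: "dist (z + s *\<^sub>R a + t *\<^sub>R b) z < min d1 d2" if "0 < s" "s < h" "0 < t" "t < h" for s t
  proof -
    have "dist (z + s *\<^sub>R a + t *\<^sub>R b) z \<le> s * norm a + t * norm b"
      using that norm_triangle_ineq[of "s *\<^sub>R a" "t *\<^sub>R b"] by (simp add: dist_norm add.assoc)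
    also have "\<dots> \<le> h * norm a + h * norm b"
      using that by (intro add_mono mult_right_mono) auto
    also have "\<dots> < h * (norm a + norm b + 1)" using h by (simp add: algebra_simps)
    also have "\<dots> = min d1 d2" using pos by (simp add: h_def)
    finally show ?thesis .
  qed
  obtain s t where st: "0 < s" "s < h" "0 < t" "t < h"
    "f (z + h *\<^sub>R a + h *\<^sub>R b) - f (z + h *\<^sub>R a) - f (z + h *\<^sub>R b) + f z
      = h\<^sup>2 * fa (z + s *\<^sub>R a + t *\<^sub>R b) b"
    using mixed_difference[OF f fa h] by metis
  obtain t' s' where ts: "0 < t'" "t' < h" "0 < s'" "s' < h"
    "f (z + h *\<^sub>R b + h *\<^sub>R a) - f (z + h *\<^sub>R b) - f (z + h *\<^sub>R a) + f z
      = h\<^sup>2 * fb (z + t' *\<^sub>R b + s' *\<^sub>R a) a"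
    using mixed_difference[OF f fb h] by metis
  have "h\<^sup>2 * fa (z + s *\<^sub>R a + t *\<^sub>R b) b = h\<^sup>2 * fb (z + s' *\<^sub>R a + t' *\<^sub>R b) a"
    using st(5) ts(5) by (simp add: algebra_simps)
  then have eq: "fa (z + s *\<^sub>R a + t *\<^sub>R b) b = fb (z + s' *\<^sub>R a + t' *\<^sub>R b) a"
    using h by simp
  have "dist (fa (z + s *\<^sub>R a + t *\<^sub>R b) b) (fa z b) < e"
    using d1 small[of s t] st by auto
  moreover have "dist (fb (z + s' *\<^sub>R a + t' *\<^sub>R b) a) (fb z a) < e"
    using d2 small[of s' t'] ts by auto
  ultimately show False using eq by (auto simp: dist_real_def e_def abs_if split: if_splits)
qed

section \<open>Commuting Wirtinger derivatives\<close>

lemma smooth_frechet: "smooth_complex g \<Longrightarrow> smooth_complex (\<lambda>z. frechet_derivative g (at z) (axis i 1))"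
  "smooth_complex g \<Longrightarrow> smooth_complex (\<lambda>z. frechet_derivative g (at z) (axis i \<i>))"
  by (simp_all add: frechet_axis_one frechet_axis_ii smooth_add smooth_diff smooth_mult smooth_dz smooth_dzbar)

lemma frechet_derivative_commute:
  assumes g: "smooth_complex g"
    and a: "smooth_complex (\<lambda>z. frechet_derivative g (at z) a)"
    and b: "smooth_complex (\<lambda>z. frechet_derivative g (at z) b)"
    and ab: "smooth_complex (\<lambda>z. frechet_derivative (\<lambda>z. frechet_derivative g (at z) a) (at z) b)"
    and ba: "smooth_complex (\<lambda>z. frechet_derivative (\<lambda>z. frechet_derivative g (at z) b) (at z) a)"
  shows "frechet_derivative (\<lambda>z. frechet_derivative g (at z) a) (at z) b
       = frechet_derivative (\<lambda>z. frechet_derivative g (at z) b) (at z) a"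
proof -
  note d = smooth_has_derivative
  have cont: "isCont f z" if "smooth_complex f" for f
    using smooth_continuous[OF that] by (simp add: continuous_on_eq_continuous_at)
  have "Re (frechet_derivative (\<lambda>z. frechet_derivative g (at z) a) (at z) b)
       = Re (frechet_derivative (\<lambda>z. frechet_derivative g (at z) b) (at z) a)"
    by (rule second_derivative_symmetric[where f = "\<lambda>z. Re (g z)" and f' = "\<lambda>z h. Re (frechet_derivative g (at z) h)"])
      (intro has_derivative_Re d g a b isCont_Re cont ab ba)+
  moreover have "Im (frechet_derivative (\<lambda>z. frechet_derivative g (at z) a) (at z) b)
       = Im (frechet_derivative (\<lambda>z. frechet_derivative g (at z) b) (at z) a)"
    by (rule second_derivative_symmetric[where f = "\<lambda>z. Im (g z)" and f' = "\<lambda>z h. Im (frechet_derivative g (at z) h)"])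
      (intro has_derivative_Im d g a b isCont_Im cont ab ba)+
  ultimately show ?thesis by (simp add: complex_eq_iff)
qed

lemma frechet_commute_axis:
  assumes g: "smooth_complex g" and "x \<in> {1, \<i>}" "y \<in> {1, \<i>}"
  shows "frechet_derivative (\<lambda>z. frechet_derivative g (at z) (axis i x)) (at z) (axis j y)
       = frechet_derivative (\<lambda>z. frechet_derivative g (at z) (axis j y)) (at z) (axis i x)"
  by (rule frechet_derivative_commute) (use assms in \<open>auto intro!: smooth_frechet\<close>)

lemma
  assumes "smooth_complex g"
  shows dz_def_fun: "dz i g = (\<lambda>z. (frechet_derivative g (at z) (axis i 1) - \<i> * frechet_derivative g (at z) (axis i \<i>)) / 2)"
   and dzbar_def_fun: "dzbar i g = (\<lambda>z. (frechet_derivative g (at z) (axis i 1) + \<i> * frechet_derivative g (at z) (axis i \<i>)) / 2)"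
  by (auto simp: dz_def dzbar_def)

lemma frechet_dz:
  assumes g: "smooth_complex g"
  shows "frechet_derivative (dz i g) (at z) v =
     (frechet_derivative (\<lambda>z. frechet_derivative g (at z) (axis i 1)) (at z) v
        - \<i> * frechet_derivative (\<lambda>z. frechet_derivative g (at z) (axis i \<i>)) (at z) v) / 2"
    and "frechet_derivative (dzbar i g) (at z) v =
     (frechet_derivative (\<lambda>z. frechet_derivative g (at z) (axis i 1)) (at z) v
        + \<i> * frechet_derivative (\<lambda>z. frechet_derivative g (at z) (axis i \<i>)) (at z) v) / 2"
proof -
  have d: "((\<lambda>z. frechet_derivative g (at z) (axis i c)) has_derivative
      frechet_derivative (\<lambda>z. frechet_derivative g (at z) (axis i c)) (at z)) (at z)" if "c \<in> {1, \<i>}" for c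
    using that g smooth_frechet smooth_has_derivative by blast
  have "(dz i g has_derivative (\<lambda>v. (frechet_derivative (\<lambda>z. frechet_derivative g (at z) (axis i 1)) (at z) v
        - \<i> * frechet_derivative (\<lambda>z. frechet_derivative g (at z) (axis i \<i>)) (at z) v) / 2)) (at z)"
    unfolding dz_def_fun[OF g] by (rule derivative_eq_intros d refl | simp)+
  from frechet_derivative_at[OF this, symmetric]
  show "frechet_derivative (dz i g) (at z) v =
     (frechet_derivative (\<lambda>z. frechet_derivative g (at z) (axis i 1)) (at z) v
        - \<i> * frechet_derivative (\<lambda>z. frechet_derivative g (at z) (axis i \<i>)) (at z) v) / 2" by simp
  have "(dzbar i g has_derivative (\<lambda>v. (frechet_derivative (\<lambda>z. frechet_derivative g (at z) (axis i 1)) (at z) v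
        + \<i> * frechet_derivative (\<lambda>z. frechet_derivative g (at z) (axis i \<i>)) (at z) v) / 2)) (at z)"
    unfolding dzbar_def_fun[OF g] by (rule derivative_eq_intros d refl | simp)+
  from frechet_derivative_at[OF this, symmetric]
  show "frechet_derivative (dzbar i g) (at z) v =
     (frechet_derivative (\<lambda>z. frechet_derivative g (at z) (axis i 1)) (at z) v
        + \<i> * frechet_derivative (\<lambda>z. frechet_derivative g (at z) (axis i \<i>)) (at z) v) / 2" by simp
qed

lemma
  assumes g: "smooth_complex g"
  shows dz_dz_commute: "dz i (dz j g) = dz j (dz i g)"
    and dz_dzbar_commute: "dz i (dzbar j g) = dzbar j (dz i g)"
    and dzbar_dzbar_commute: "dzbar i (dzbar j g) = dzbar j (dzbar i g)"
proof -
  note c = frechet_commute_axis[OF g, of 1 1] frechet_commute_axis[OF g, of 1 \<i>]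
    frechet_commute_axis[OF g, of \<i> 1] frechet_commute_axis[OF g, of \<i> \<i>]
  show "dz i (dz j g) = dz j (dz i g)"
    unfolding dz_def[of i "dz j g"] dz_def[of j "dz i g"] frechet_dz[OF g]
    using c by (auto simp: field_simps)
  show "dz i (dzbar j g) = dzbar j (dz i g)"
    unfolding dz_def[of i "dzbar j g"] dzbar_def[of j "dz i g"] frechet_dz[OF g]
    using c by (auto simp: field_simps)
  show "dzbar i (dzbar j g) = dzbar j (dzbar i g)"
    unfolding dzbar_def[of i "dzbar j g"] dzbar_def[of j "dzbar i g"] frechet_dz[OF g]
    using c by (auto simp: field_simps)
qed

text \<open>Bridge from the real notion \<open>Ck_on\<close>: the basis vectors of the complex plane
  squared are \<open>axis i 1\<close> and \<open>axis i \<i>\<close>, and the two partials along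
  them combine to \<open>dz i\<close> and \<open>dzbar i\<close>.\<close>

lemma Ck_complex_of_real:
  "Ck_on k g UNIV \<Longrightarrow> Ck_complex k (\<lambda>w. complex_of_real (g w))"
proof (induction k arbitrary: g)
  case 0
  then show ?case by (auto intro!: continuous_intros)
next
  case (Suc k)
  have d: "(g has_derivative frechet_derivative g (at z)) (at z)" for z
    using Suc.prems by (auto simp: differentiable_on_def frechet_derivative_works)
  have d': "((\<lambda>w. complex_of_real (g w)) has_derivative (\<lambda>h. complex_of_real (frechet_derivative g (at z) h))) (at z)" for z
    using d by (rule has_derivative_of_real)
  have C: "Ck_complex k (\<lambda>w. complex_of_real (frechet_derivative g (at w) (axis i c)))"
    if "c = 1 \<or> c = \<i>" for i c
    using that Suc by (auto simp: Basis_vec_def Basis_complex_def)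
  have "Ck_complex k (\<lambda>w. complex_of_real (frechet_derivative g (at w) (axis i 1)) / 2 +
     (- \<i> / 2) * complex_of_real (frechet_derivative g (at w) (axis i \<i>)))"
    "Ck_complex k (\<lambda>w. complex_of_real (frechet_derivative g (at w) (axis i 1)) / 2 +
     (\<i> / 2) * complex_of_real (frechet_derivative g (at w) (axis i \<i>)))" for i
    using Ck_complex_add[OF Ck_complex_mult[OF Ck_complex_const[of k "1/2"] C[of 1 i]]
       Ck_complex_mult[OF Ck_complex_const[of k "- \<i> / 2"] C[of \<i> i]]]
     Ck_complex_add[OF Ck_complex_mult[OF Ck_complex_const[of k "1/2"] C[of 1 i]]
       Ck_complex_mult[OF Ck_complex_const[of k "\<i> / 2"] C[of \<i> i]]] by simp_all
  moreover have "dz i (\<lambda>w. complex_of_real (g w)) = (\<lambda>w. complex_of_real (frechet_derivative g (at w) (axis i 1)) / 2 +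
     (- \<i> / 2) * complex_of_real (frechet_derivative g (at w) (axis i \<i>)))"
    "dzbar i (\<lambda>w. complex_of_real (g w)) = (\<lambda>w. complex_of_real (frechet_derivative g (at w) (axis i 1)) / 2 +
     (\<i> / 2) * complex_of_real (frechet_derivative g (at w) (axis i \<i>)))" for i
    using dz_eq[OF d'] dzbar_eq[OF d'] by (auto simp: field_simps)
  moreover have "(\<lambda>w. complex_of_real (g w)) differentiable (at z)" for z
    using d' differentiableI by blast
  ultimately show ?case by auto
qed

lemma smooth_of_real: "smooth_on g UNIV \<Longrightarrow> smooth_complex (\<lambda>w. complex_of_real (g w))"
  by (simp add: smooth_on_def smooth_complex_def Ck_complex_of_real)

subsection \<open>Curvature of a Kaehler potential\<close>

lemma matrix_inv_eqI:
  fixes A B :: "'a::field ^ 'n ^ 'n"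
  assumes "A ** B = mat 1" "B ** A = mat 1"
  shows "matrix_inv A = B"
proof -
  have "A ** matrix_inv A = mat 1 \<and> matrix_inv A ** A = mat 1"
    unfolding matrix_inv_def by (rule someI[where x = B]) (use assms in simp)
  then have "matrix_inv A = matrix_inv A ** (A ** B)" "matrix_inv A ** A = mat 1"
    using assms by simp_all
  then show ?thesis by (metis matrix_mul_assoc matrix_mul_lid)
qed

lemma smooth_realpart_differentiable_ln:
  assumes W: "smooth_complex W" and pos: "\<And>z. Re (W z) > 0"
  shows "(\<lambda>w. complex_of_real (ln (Re (W w)))) differentiable (at z)"
proof -
  have "((\<lambda>w. Re (W w)) has_derivative (\<lambda>h. Re (frechet_derivative W (at z) h))) (at z)"
    by (intro has_derivative_Re smooth_has_derivative W)
  from has_derivative_of_real[OF has_derivative_ln[OF _ this]] pos[of z]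
  show ?thesis using differentiableI by blast
qed

locale kahler =
  fixes F :: "complex ^ 2 \<Rightarrow> real"
  assumes kahler: "kahler_potential F"
begin

definition Fc where "Fc = (\<lambda>w. complex_of_real (F w))"
definition h where "h i j = dz i (dzbar j Fc)"
definition W where "W = (\<lambda>w. h 1 1 w * h 2 2 w - h 1 2 w * h 2 1 w)"
definition V where "V = (\<lambda>w. complex_of_real (logV F w))"
text \<open>The cofactor formula for \<open>inv_hess\<close>, chosen because smoothness can be read
  off from it. In the type 2, \<open>3 - i\<close> is the index other than \<open>i\<close>; the
  off-diagonal entry is \<open>h j i\<close> since the second index of the inverse is the barred
  one.\<close>

definition G :: "2 \<Rightarrow> 2 \<Rightarrow> complex ^ 2 \<Rightarrow> complex" where
  "G i j = (\<lambda>w. (if i = j then h (3 - i) (3 - i) w else - h j i w) * inverse (W w))"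

lemma Fc_smooth: "smooth_complex Fc"
  using kahler smooth_of_real by (auto simp: kahler_potential_def Fc_def)

lemma h_smooth: "smooth_complex (h i j)"
  by (simp add: h_def smooth_dz smooth_dzbar Fc_smooth)

lemma hess_F: "hess F w $ i $ j = h i j w"
  by (simp add: hess_def h_def Fc_def)

lemma dz_Fc: "cnj (dz i Fc w) = dzbar i Fc w"
proof -
  have "Fc = (\<lambda>w. cnj (Fc w))" by (simp add: Fc_def)
  then show ?thesis using dzbar_cnj[OF Fc_smooth, of i] by metis
qed

lemma cnj_h: "cnj (h i j w) = h j i w"
proof -
  have "(\<lambda>w. cnj (dz j Fc w)) = dzbar j Fc" by (auto simp: dz_Fc)
  then have "h i j = (\<lambda>w. cnj (dzbar i (dz j Fc) w))"
    unfolding h_def using dz_cnj[OF smooth_dz[OF Fc_smooth], of i j] by simp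
  then show ?thesis
    by (simp add: h_def dz_dzbar_commute[OF Fc_smooth])
qed

lemma h_pos: "x \<noteq> 0 \<or> y \<noteq> 0 \<Longrightarrow>
  Re (h 1 1 w * x * cnj x + h 1 2 w * x * cnj y + h 2 1 w * y * cnj x + h 2 2 w * y * cnj y) > 0"
proof -
  assume "x \<noteq> 0 \<or> y \<noteq> 0"
  then have "(vector [x, y] :: complex ^ 2) \<noteq> 0"
    by (auto simp: vec_eq_iff forall_2)
  with kahler have "Re (\<Sum>i\<in>UNIV. \<Sum>j\<in>UNIV. hess F w $ i $ j * vector [x, y] $ i * cnj (vector [x, y] $ j)) > 0"
    unfolding kahler_potential_def by blast
  then show ?thesis by (simp add: sum_2 hess_F add.assoc)
qed

lemma h_diag_real: "h i i w = complex_of_real (Re (h i i w))"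
  using cnj_h[of i i w] by (simp add: complex_eq_iff)

lemma h_diag_pos: "Re (h i i w) > 0"
  using h_pos[of 1 0 w] h_pos[of 0 1 w] exhaust_2[of i] by auto

lemma W_real: "W w = complex_of_real (Re (W w))"
proof -
  have "cnj (W w) = W w" by (simp add: W_def cnj_h mult.commute)
  then show ?thesis by (simp add: complex_eq_iff)
qed

lemma W_pos: "Re (W w) > 0"
proof -
  \<comment> \<open>The test vector (- h 2 1, h 1 1) is chosen so that the Hermitian form takes the
    value h 1 1 * W.\<close>
  have "Re (h 1 1 w * (- h 2 1 w) * cnj (- h 2 1 w) + h 1 2 w * (- h 2 1 w) * cnj (h 1 1 w)
    + h 2 1 w * h 1 1 w * cnj (- h 2 1 w) + h 2 2 w * h 1 1 w * cnj (h 1 1 w)) > 0"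
    using h_diag_pos[of 1 w] by (intro h_pos) auto
  also have "h 1 1 w * (- h 2 1 w) * cnj (- h 2 1 w) + h 1 2 w * (- h 2 1 w) * cnj (h 1 1 w)
    + h 2 1 w * h 1 1 w * cnj (- h 2 1 w) + h 2 2 w * h 1 1 w * cnj (h 1 1 w) = h 1 1 w * W w"
    by (simp add: cnj_h W_def algebra_simps)
  also have "\<dots> = complex_of_real (Re (h 1 1 w) * Re (W w))"
    using h_diag_real[of 1 w] W_real[of w] by (metis of_real_mult)
  finally show ?thesis using h_diag_pos[of 1 w] by (simp add: zero_less_mult_iff)
qed

lemma W_nonzero: "W w \<noteq> 0"
  using W_pos[of w] by auto

lemma detW_eq: "detW F w = Re (W w)"
  by (simp add: detW_def det_2 hess_F W_def)

lemma W_smooth: "smooth_complex W"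
  unfolding W_def by (intro smooth_diff smooth_mult h_smooth)

lemma G_smooth: "smooth_complex (G i j)"
  unfolding G_def
  by (cases "i = j") (auto intro!: smooth_mult smooth_uminus smooth_inverse h_smooth W_smooth W_nonzero simp del: mult_minus_left)

lemma cnj_W: "cnj (W w) = W w"
  using W_real[of w] by (metis complex_cnj_complex_of_real)

lemma cnj_G: "cnj (G i j w) = G j i w"
  by (simp add: G_def cnj_h cnj_W)

lemma G_explicit:
  "G 1 1 w = h 2 2 w * inverse (W w)" "G 1 2 w = - h 2 1 w * inverse (W w)"
  "G 2 1 w = - h 1 2 w * inverse (W w)" "G 2 2 w = h 1 1 w * inverse (W w)"
  by (simp_all add: G_def)

lemma G_h: "(\<Sum>j\<in>UNIV. G i j w * h k j w) = (if i = k then 1 else 0)"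
  and h_G: "(\<Sum>i\<in>UNIV. h i k w * G i j w) = (if k = j then 1 else 0)"
proof -
  have "W w * inverse (W w) = 1" using W_nonzero by simp
  then have e: "(h 1 1 w * h 2 2 w - h 1 2 w * h 2 1 w) * inverse (W w) = 1"
    by (simp add: W_def)
  show "(\<Sum>j\<in>UNIV. G i j w * h k j w) = (if i = k then 1 else 0)"
    using exhaust_2[of i] exhaust_2[of k] e by (auto simp: sum_2 G_explicit algebra_simps)
  show "(\<Sum>i\<in>UNIV. h i k w * G i j w) = (if k = j then 1 else 0)"
    using exhaust_2[of k] exhaust_2[of j] e by (auto simp: sum_2 G_explicit algebra_simps)
qed

lemma inv_hess_eq: "inv_hess F w $ i $ j = G i j w"
proof -
  define B where "B = (\<chi> i j. G j i w)"
  have "(\<Sum>k\<in>UNIV. h i k w * G j k w) = (if i = j then 1 else 0)" for i j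
    using G_h[of j w i] by (auto simp: mult.commute)
  then have 1: "hess F w ** B = mat 1"
    by (simp add: matrix_matrix_mult_def B_def hess_F mat_def vec_eq_iff)
  have "(\<Sum>k\<in>UNIV. G k i w * h k j w) = (if i = j then 1 else 0)" for i j
    using h_G[of j w i] by (auto simp: mult.commute)
  then have 2: "B ** hess F w = mat 1"
    by (simp add: matrix_matrix_mult_def B_def hess_F mat_def vec_eq_iff)
  have "matrix_inv (hess F w) = B" by (rule matrix_inv_eqI[OF 1 2])
  then show ?thesis by (simp add: inv_hess_def transpose_def B_def)
qed

lemma exp_V: "exp (V w) = W w"
  using W_pos[of w] W_real[of w] by (simp add: V_def logV_def detW_eq exp_of_real)

lemma V_differentiable: "V differentiable (at z)"
  unfolding V_def logV_def detW_eq
  by (rule smooth_realpart_differentiable_ln[OF W_smooth W_pos])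

text \<open>Obtained by differentiating \<open>exp V = W\<close>. Only differentiability of
  \<open>V\<close> is needed for this, and the formula then gives its smoothness.\<close>

lemma dz_V': "dz k V = (\<lambda>w. dz k W w * inverse (W w))"
  and dzbar_V': "dzbar k V = (\<lambda>w. dzbar k W w * inverse (W w))"
  using dz_exp'[OF V_differentiable, of k] dzbar_exp'[OF V_differentiable, of k] W_nonzero
  by (auto simp: exp_V fun_eq_iff field_simps)

lemma V_smooth: "smooth_complex V"
  by (rule smoothI[OF V_differentiable])
    (auto simp: dz_V' dzbar_V' intro!: smooth_mult smooth_inverse smooth_dz smooth_dzbar W_smooth W_nonzero)

lemma cnj_dz_V: "cnj (dz k V w) = dzbar k V w" and cnj_dzbar_V: "cnj (dzbar k V w) = dz k V w"
proof -
  have "(\<lambda>w. cnj (V w)) = V" by (simp add: V_def)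
  then show "cnj (dz k V w) = dzbar k V w" "cnj (dzbar k V w) = dz k V w"
    using dzbar_cnj[OF V_smooth, of k] dz_cnj[OF V_smooth, of k] by metis+
qed

text \<open>The Kaehler condition in coordinates: the metric is the mixed Hessian of a potential, so
  unbarred indices may be exchanged with the derivative.\<close>

lemma dz_h: "dz k (h i j) = dz i (h k j)"
  unfolding h_def by (simp add: dz_dz_commute smooth_dzbar Fc_smooth)

lemma dzbar_h: "dzbar k (h i j) = dzbar j (h i k)"
  unfolding h_def
  by (simp add: dz_dzbar_commute[symmetric] smooth_dzbar smooth_dz Fc_smooth dzbar_dzbar_commute)

text \<open>Jacobi's formula for the derivative of a determinant, divided by
  \<open>W\<close>.\<close>

lemma dz_V: "dz k V w = (\<Sum>i\<in>UNIV. \<Sum>j\<in>UNIV. G i j w * dz k (h i j) w)"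
proof -
  have "dz k W w = dz k (h 1 1) w * h 2 2 w + h 1 1 w * dz k (h 2 2) w
      - (dz k (h 1 2) w * h 2 1 w + h 1 2 w * dz k (h 2 1) w)"
    unfolding W_def by (simp add: dz_diff dz_mult h_smooth smooth_mult)
  note W' = this
  show ?thesis unfolding dz_V' W' by (simp add: sum_2 G_explicit algebra_simps)
qed

text \<open>The negative Christoffel symbols: \<open>Chr k p i = - \<Gamma>\<^sup>p\<^sub>k\<^sub>i\<close>.\<close>

definition Chr where "Chr k p i = (\<lambda>w. - (\<Sum>q\<in>UNIV. G p q w * dz k (h i q) w))"

lemma Chr_smooth: "smooth_complex (Chr k p i)"
  unfolding Chr_def by (intro smooth_uminus smooth_sum smooth_mult G_smooth smooth_dz h_smooth)

lemma Chr_sym: "Chr k p i = Chr i p k"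
  unfolding Chr_def by (simp add: dz_h[of k i])

text \<open>By \<open>dz_h\<close> the trace over the first lower index equals the trace over the
  second, which is Jacobi's formula \<open>dz_V\<close>.\<close>

lemma Chr_trace: "(\<Sum>l\<in>UNIV. Chr l l q w) = - dz q V w"
  unfolding Chr_def dz_V using dz_h[of q] by (simp add: sum_negf)

text \<open>The rule for the derivative of an inverse matrix: differentiate \<open>G_h\<close> and
  multiply by \<open>G\<close>.\<close>

lemma dz_G: "dz k (G p j) w = (\<Sum>i\<in>UNIV. Chr k p i w * G i j w)"
proof -
  have C: "(\<Sum>q\<in>UNIV. dz k (G p q) w * h i q w) = Chr k p i w" for i
  proof -
    have "dz k (\<lambda>w. \<Sum>q\<in>UNIV. G p q w * h i q w) w = 0" by (simp add: G_h)
    then show ?thesis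
      by (simp add: dz_sum dz_mult G_smooth h_smooth smooth_mult sum.distrib Chr_def eq_neg_iff_add_eq_0)
  qed
  have "dz k (G p j) w = (\<Sum>q\<in>UNIV. dz k (G p q) w * (if q = j then 1 else 0))"
    using exhaust_2[of j] by (auto simp: sum_2)
  also have "\<dots> = (\<Sum>q\<in>UNIV. \<Sum>i\<in>UNIV. dz k (G p q) w * (h i q w * G i j w))"
    by (simp add: h_G sum_distrib_left[symmetric])
  also have "\<dots> = (\<Sum>i\<in>UNIV. (\<Sum>q\<in>UNIV. dz k (G p q) w * h i q w) * G i j w)"
    by (simp add: sum_2 algebra_simps)
  finally show ?thesis by (simp add: C)
qed

lemma dzbar_G: "dzbar l (G i j) w = (\<Sum>q\<in>UNIV. G i q w * cnj (Chr l j q w))"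
proof -
  have "G i j = (\<lambda>w. cnj (G j i w))" by (simp add: cnj_G)
  then have "dzbar l (G i j) w = cnj (dz l (G j i) w)"
    using dzbar_cnj[OF G_smooth, of l j i] by simp
  then show ?thesis by (simp add: dz_G cnj_G mult.commute)
qed

text \<open>The negative of the Kaehler curvature tensor in the convention R = - ddbar h + dh h^{-1}
  dbar h. The index pairs are (q, rbar) for the metric and (l, kbar) for the derivatives.\<close>

definition Rm where "Rm q l r k = (\<lambda>w. dzbar k (dz l (h q r)) w
  - (\<Sum>s\<in>UNIV. \<Sum>m\<in>UNIV. dzbar k (h s r) w * G s m w * dz l (h q m) w))"

lemma Rm_sym: "Rm q l r k = Rm q l k r"
proof -
  have "dzbar k (dz l (h q r)) = dzbar r (dz l (h q k))"
    using dz_dzbar_commute[OF h_smooth] dzbar_h by metis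
  then show ?thesis unfolding Rm_def using dzbar_h[of k _ r] by simp
qed

lemma cnj_Chr: "cnj (Chr l j q w) = - (\<Sum>r\<in>UNIV. G r j w * dzbar l (h r q) w)"
proof -
  have "cnj (dz l (h q r) w) = dzbar l (h r q) w" for r
  proof -
    have "h r q = (\<lambda>w. cnj (h q r w))" by (simp add: cnj_h)
    then show ?thesis using dzbar_cnj[OF h_smooth] by simp
  qed
  then show ?thesis by (simp add: Chr_def cnj_G)
qed

lemma dzbar_Chr: "dzbar k (Chr l j q) w = - (\<Sum>r\<in>UNIV. G j r w * Rm q l r k w)"
proof -
  have "dzbar k (Chr l j q) w
    = - (\<Sum>m\<in>UNIV. dzbar k (G j m) w * dz l (h q m) w + G j m w * dzbar k (dz l (h q m)) w)"
    unfolding Chr_def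
    by (simp add: dzbar_uminus dzbar_sum dzbar_mult G_smooth h_smooth smooth_dz smooth_mult smooth_sum)
  then show ?thesis
    by (simp add: dzbar_G cnj_Chr Rm_def sum_2 algebra_simps)
qed

text \<open>The Ricci form is \<open>- \<partial>\<partial>bar log W\<close>: both traces of the curvature agree by the symmetry
  \<open>Rm_sym\<close>.\<close>

lemma Ricci_trace:
  "(\<Sum>k\<in>UNIV. \<Sum>l\<in>UNIV. G l k w * dzbar k (Chr l p j) w) = - (\<Sum>r\<in>UNIV. G p r w * dzbar r (dz j V) w)"
proof -
  have "dz j V = (\<lambda>w. - (\<Sum>l\<in>UNIV. Chr l l j w))" by (simp add: Chr_trace)
  then have "dzbar r (dz j V) w = - (\<Sum>l\<in>UNIV. dzbar r (Chr l l j) w)" for r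
    by (simp add: dzbar_uminus dzbar_sum Chr_smooth smooth_sum)
  then have "(\<Sum>r\<in>UNIV. G p r w * dzbar r (dz j V) w)
     = (\<Sum>r\<in>UNIV. \<Sum>l\<in>UNIV. \<Sum>k\<in>UNIV. G p r w * G l k w * Rm j l k r w)"
    by (simp add: dzbar_Chr sum_2 algebra_simps)
  also have "\<dots> = (\<Sum>r\<in>UNIV. \<Sum>l\<in>UNIV. \<Sum>k\<in>UNIV. G p r w * G l k w * Rm j l r k w)"
    by (subst Rm_sym) (rule refl)
  finally show ?thesis
    by (simp add: dzbar_Chr sum_2 algebra_simps)
qed

section \<open>The Hermitian pairing of (1,0)-forms and the Chern connection\<close>

definition ip :: "(2 \<Rightarrow> complex ^ 2 \<Rightarrow> complex) \<Rightarrow> (2 \<Rightarrow> complex ^ 2 \<Rightarrow> complex) \<Rightarrow> complex ^ 2 \<Rightarrow> complex" where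
  "ip a c = (\<lambda>w. \<Sum>i\<in>UNIV. \<Sum>j\<in>UNIV. G i j w * a i w * cnj (c j w))"

text \<open>The covariant derivative on (1,0)-forms; the sign is plus because \<open>Chr\<close> is
  the negative Christoffel symbol.\<close>

definition nab where "nab k a i = (\<lambda>w. dz k (a i) w + (\<Sum>p\<in>UNIV. a p w * Chr k p i w))"

lemma ip_smooth: "(\<And>i. smooth_complex (a i)) \<Longrightarrow> (\<And>i. smooth_complex (c i)) \<Longrightarrow> smooth_complex (ip a c)"
  unfolding ip_def by (intro smooth_sum smooth_mult smooth_cnj G_smooth)

lemma nab_smooth: "(\<And>i. smooth_complex (a i)) \<Longrightarrow> smooth_complex (nab k a i)"
  unfolding nab_def by (intro smooth_add smooth_sum smooth_mult smooth_dz Chr_smooth)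

text \<open>Compatibility of the Chern connection with the metric. Its (0,1) part is the plain
  \<open>dzbar\<close>, so Christoffel symbols appear only in the unconjugated slot.\<close>

lemma dz_ip:
  assumes a: "\<And>i. smooth_complex (a i)" and c: "\<And>i. smooth_complex (c i)"
  shows "dz k (ip a c) w = ip (nab k a) c w + ip a (\<lambda>j. dzbar k (c j)) w"
proof -
  have "dz k (ip a c) w = (\<Sum>i\<in>UNIV. \<Sum>j\<in>UNIV. (dz k (G i j) w * a i w + G i j w * dz k (a i) w) * cnj (c j w)
     + G i j w * a i w * cnj (dzbar k (c j) w))"
    unfolding ip_def
    by (simp add: dz_sum dz_mult dz_cnj a c G_smooth smooth_mult smooth_sum smooth_cnj)
  then show ?thesis
    by (simp add: ip_def nab_def dz_G sum_2 algebra_simps)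
qed

lemma dzbar_ip:
  assumes a: "\<And>i. smooth_complex (a i)" and c: "\<And>i. smooth_complex (c i)"
  shows "dzbar k (ip a c) w = ip a (nab k c) w + ip (\<lambda>j. dzbar k (a j)) c w"
proof -
  have "dzbar k (ip a c) w = (\<Sum>i\<in>UNIV. \<Sum>j\<in>UNIV. (dzbar k (G i j) w * a i w + G i j w * dzbar k (a i) w) * cnj (c j w)
     + G i j w * a i w * cnj (dz k (c j) w))"
    unfolding ip_def
    by (simp add: dzbar_sum dzbar_mult dzbar_cnj a c G_smooth smooth_mult smooth_sum smooth_cnj)
  then show ?thesis
    by (simp add: ip_def nab_def dzbar_G sum_2 algebra_simps)
qed

text \<open>The Laplacian before taking real parts, so that it is complex linear and products can be
  expanded freely.\<close>

definition L where "L u = (\<lambda>w. \<Sum>k\<in>UNIV. \<Sum>l\<in>UNIV. G k l w * dz k (dzbar l u) w)"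

lemma Box_eq: "Box F g w = Re (L (\<lambda>w. complex_of_real (g w)) w)"
  by (simp add: Box_def L_def inv_hess_eq hess_def)

subsection \<open>The twisted Bochner formula\<close>

definition db where "db l a = (\<lambda>i. dzbar l (a i))" for a :: "2 \<Rightarrow> complex ^ 2 \<Rightarrow> complex"
text \<open>This is e^{-g} \<nabla>(e^g a), the connection that belongs to the metric with the
  weight \<open>exp g\<close>.\<close>

definition tw where "tw g k a i = (\<lambda>w. nab k a i w + dz k g w * a i w)"
  for a :: "2 \<Rightarrow> complex ^ 2 \<Rightarrow> complex"

lemma ip_add_left: "ip (\<lambda>i w. a i w + a' i w) c w = ip a c w + ip a' c w"
  and ip_add_right: "ip a (\<lambda>i w. c i w + c' i w) w = ip a c w + ip a c' w"
  and ip_scale_left: "ip (\<lambda>i w. s w * a i w) c w = s w * ip a c w"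
  and ip_scale_right: "ip a (\<lambda>i w. s w * c i w) w = cnj (s w) * ip a c w"
  by (simp_all add: ip_def sum_2 algebra_simps)

text \<open>The commutator of the two halves of the connection; its term of order zero in
  \<open>a\<close> is the curvature.\<close>

lemma dzbar_nab:
  assumes a: "\<And>i. smooth_complex (a i)"
  shows "dzbar k (nab l a j) = (\<lambda>w. nab l (db k a) j w + (\<Sum>p\<in>UNIV. a p w * dzbar k (Chr l p j) w))"
  unfolding nab_def db_def
  by (simp add: dzbar_add dzbar_sum dzbar_mult a smooth_dz smooth_mult smooth_sum Chr_smooth
      dz_dzbar_commute sum.distrib add.assoc)

lemma twisted_bochner_pointwise:
  assumes a: "\<And>i. smooth_complex (a i)" and g: "smooth_complex g" and g_real: "\<And>w. cnj (g w) = g w"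
  shows "dz k (dzbar l (\<lambda>w. exp (g w) * ip a a w)) w = exp (g w) *
    (ip (tw g k a) (tw g l a) w + ip (db l a) (db k a) w + ip (tw g k (db l a)) a w
     + ip a (tw g l (db k a)) w + dz k (dzbar l g) w * ip a a w
     + ip a (\<lambda>j w. \<Sum>p\<in>UNIV. a p w * dzbar k (Chr l p j) w) w)"
proof -
  have b: "smooth_complex (db k a i)" for k i
    by (simp add: db_def smooth_dzbar a)
  note sm = a b g nab_smooth ip_smooth smooth_exp smooth_mult smooth_add smooth_dzbar smooth_dz
  \<comment> \<open>Reality of \<open>g\<close> turns the conjugated twist in the second slot into
    \<open>dzbar l g\<close>; this is what assembles the twisted square.\<close>
  have cg: "cnj (dz l g w) = dzbar l g w" for w
  proof -
    have "(\<lambda>w. cnj (g w)) = g" using g_real by auto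
    then show ?thesis using dzbar_cnj[OF g, of l] by metis
  qed
  have "dzbar l (\<lambda>w. exp (g w) * ip a a w)
      = (\<lambda>w. exp (g w) * (dzbar l g w * ip a a w + ip a (nab l a) w + ip (db l a) a w))"
    by (auto simp: dzbar_mult dzbar_exp dzbar_ip sm db_def algebra_simps)
  then have "dz k (dzbar l (\<lambda>w. exp (g w) * ip a a w)) w
      = exp (g w) * (dz k g w * (dzbar l g w * ip a a w + ip a (nab l a) w + ip (db l a) a w)
         + (dz k (dzbar l g) w * ip a a w + dzbar l g w * (ip (nab k a) a w + ip a (db k a) w)
         + (ip (nab k a) (nab l a) w + ip a (\<lambda>j. dzbar k (nab l a j)) w)
         + (ip (nab k (db l a)) a w + ip (db l a) (db k a) w)))"
    by (simp add: dz_mult dz_exp dz_add dz_ip sm algebra_simps flip: db_def)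
  then show ?thesis
    unfolding tw_def ip_add_left ip_add_right ip_scale_left ip_scale_right dzbar_nab[OF a] cg
    by (simp add: algebra_simps)
qed

text \<open>Conjugation of the second slot exchanges the indices of \<open>G k l\<close>, which
  produces the trace evaluated by \<open>Ricci_trace\<close>.\<close>

lemma ip_Ricci:
  "(\<Sum>k\<in>UNIV. \<Sum>l\<in>UNIV. G k l w * ip a (\<lambda>j w. \<Sum>p\<in>UNIV. a p w * dzbar k (Chr l p j) w) w)
   = - ip a (\<lambda>j w. \<Sum>p\<in>UNIV. \<Sum>r\<in>UNIV. a p w * G p r w * dzbar r (dz j V) w) w"
proof -
  have "(\<Sum>k\<in>UNIV. \<Sum>l\<in>UNIV. G k l w * ip a (\<lambda>j w. \<Sum>p\<in>UNIV. a p w * dzbar k (Chr l p j) w) w)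
     = ip a (\<lambda>j w. \<Sum>p\<in>UNIV. a p w * (\<Sum>k\<in>UNIV. \<Sum>l\<in>UNIV. G l k w * dzbar k (Chr l p j) w)) w"
    by (simp add: ip_def sum_2 cnj_G algebra_simps)
  also have "\<dots> = - ip a (\<lambda>j w. \<Sum>p\<in>UNIV. \<Sum>r\<in>UNIV. a p w * G p r w * dzbar r (dz j V) w) w"
    unfolding Ricci_trace by (simp add: ip_def sum_2 algebra_simps)
  finally show ?thesis .
qed

lemma L_twisted:
  assumes a: "\<And>i. smooth_complex (a i)" and g: "smooth_complex g" and g_real: "\<And>w. cnj (g w) = g w"
  shows "L (\<lambda>w. exp (g w) * ip a a w) w = exp (g w) *
    ((\<Sum>k\<in>UNIV. \<Sum>l\<in>UNIV. G k l w * ip (tw g k a) (tw g l a) w)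
     + (\<Sum>k\<in>UNIV. \<Sum>l\<in>UNIV. G k l w * ip (db l a) (db k a) w)
     + (\<Sum>k\<in>UNIV. \<Sum>l\<in>UNIV. G k l w * ip (tw g k (db l a)) a w)
     + (\<Sum>k\<in>UNIV. \<Sum>l\<in>UNIV. G k l w * ip a (tw g l (db k a)) w)
     + L g w * ip a a w
     - ip a (\<lambda>j w. \<Sum>p\<in>UNIV. \<Sum>r\<in>UNIV. a p w * G p r w * dzbar r (dz j V) w) w)"
  unfolding L_def twisted_bochner_pointwise[OF a g g_real] diff_conv_add_uminus ip_Ricci[symmetric]
  by (simp only: sum_2 distrib_left distrib_right mult_ac add_ac)

text \<open>The Cholesky factorisation, with p = G 1 1 and d = det G = 1/W. It turns each
  contraction with \<open>G\<close> below into a sum of squared norms.\<close>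

lemma G_factor:
  obtains S :: "2 \<Rightarrow> 2 \<Rightarrow> complex" where "\<And>i j. G i j w = (\<Sum>m\<in>UNIV. S i m * cnj (S j m))"
proof -
  define p where "p = Re (G 1 1 w)"
  define d where "d = inverse (Re (W w))"
  have Wi: "inverse (W w) = complex_of_real d"
    using W_real[of w] unfolding d_def by (metis of_real_inverse)
  have d: "d > 0" using W_pos[of w] by (simp add: d_def)
  have G11: "G 1 1 w = complex_of_real p"
    using cnj_G[of 1 1 w] by (simp add: p_def complex_eq_iff)
  have "p = Re (h 2 2 w) * d"
    unfolding p_def G_explicit Wi by simp
  then have p: "p > 0" using h_diag_pos[of 2 w] d by simp
  have det: "G 1 1 w * G 2 2 w - G 1 2 w * G 2 1 w = complex_of_real d"
  proof -
    have "G 1 1 w * G 2 2 w - G 1 2 w * G 2 1 w = W w * inverse (W w) * inverse (W w)"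
      unfolding G_explicit by (simp add: W_def algebra_simps)
    moreover have "W w * inverse (W w) = 1" using W_nonzero by simp
    ultimately show ?thesis using Wi by simp
  qed
  define S :: "2 \<Rightarrow> 2 \<Rightarrow> complex" where
    "S i m = (if m = 1 then G i 1 w / complex_of_real (sqrt p)
       else if i = 1 then 0 else complex_of_real (sqrt (d / p)))" for i m
  have sq: "complex_of_real (sqrt p) * complex_of_real (sqrt p) = complex_of_real p"
    "complex_of_real (sqrt (d / p)) * complex_of_real (sqrt (d / p)) = complex_of_real d / complex_of_real p"
    using p d by (simp_all flip: of_real_mult of_real_divide)
  have "G i j w = (\<Sum>m\<in>UNIV. S i m * cnj (S j m))" for i j
    using exhaust_2[of i] exhaust_2[of j] p det
    by (auto simp: sum_2 S_def sq G11 cnj_G field_simps)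
  then show ?thesis using that by blast
qed

lemma cnj_ip: "cnj (ip a c w) = ip c a w"
  by (simp add: ip_def cnj_G sum_2 algebra_simps)

lemma ip_self_real: "ip a a w = complex_of_real (Re (ip a a w))"
  using cnj_ip[of a a w] by (simp add: complex_eq_iff)

lemma ip_self_nonneg: "Re (ip a a w) \<ge> 0"
proof -
  obtain S :: "2 \<Rightarrow> 2 \<Rightarrow> complex" where S: "\<And>i j. G i j w = (\<Sum>m\<in>UNIV. S i m * cnj (S j m))"
    using G_factor[of w] by metis
  have "ip a a w = (\<Sum>m\<in>UNIV. (\<Sum>i\<in>UNIV. S i m * a i w) * cnj (\<Sum>i\<in>UNIV. S i m * a i w))"
    by (simp add: ip_def S sum_2 algebra_simps)
  then show ?thesis unfolding complex_mult_cnj by (simp add: sum_2)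
qed

lemma tensor_nonneg:
  "Re (\<Sum>k\<in>UNIV. \<Sum>l\<in>UNIV. G k l w * ip (X k) (X l) w) \<ge> 0"
proof -
  obtain S :: "2 \<Rightarrow> 2 \<Rightarrow> complex" where S: "\<And>i j. G i j w = (\<Sum>m\<in>UNIV. S i m * cnj (S j m))"
    using G_factor[of w] by metis
  have "(\<Sum>k\<in>UNIV. \<Sum>l\<in>UNIV. G k l w * ip (X k) (X l) w)
     = (\<Sum>m\<in>UNIV. ip (\<lambda>i w. \<Sum>k\<in>UNIV. S k m * X k i w) (\<lambda>i w. \<Sum>k\<in>UNIV. S k m * X k i w) w)"
    by (simp add: ip_def S[of 1] S[of 2] sum_2 algebra_simps)
  then show ?thesis by (simp add: ip_self_nonneg sum_2)
qed

text \<open>The version for tensors whose first index is barred, such as \<open>db l a\<close>: the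
  index l now belongs to the unconjugated factor, and conjugates of the Cholesky coefficients
  appear.\<close>

lemma tensor_nonneg':
  "Re (\<Sum>k\<in>UNIV. \<Sum>l\<in>UNIV. G k l w * ip (X l) (X k) w) \<ge> 0"
proof -
  obtain S :: "2 \<Rightarrow> 2 \<Rightarrow> complex" where S: "\<And>i j. G i j w = (\<Sum>m\<in>UNIV. S i m * cnj (S j m))"
    using G_factor[of w] by metis
  have "(\<Sum>k\<in>UNIV. \<Sum>l\<in>UNIV. G k l w * ip (X l) (X k) w)
     = (\<Sum>m\<in>UNIV. ip (\<lambda>i w. \<Sum>k\<in>UNIV. cnj (S k m) * X k i w) (\<lambda>i w. \<Sum>k\<in>UNIV. cnj (S k m) * X k i w) w)"
    by (simp add: ip_def S[of 1] S[of 2] sum_2 algebra_simps)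
  then show ?thesis by (simp add: ip_self_nonneg sum_2)
qed

section \<open>The Ricci form and the gradient of V\<close>

definition dV where "dV = (\<lambda>i. dz i V)"

text \<open>\<open>Ric2\<close> is the squared norm of ddbar V, that is, of the Ricci form;
  \<open>rho a\<close> is ddbar V evaluated on the vector that the metric assigns to
  \<open>a\<close>.\<close>

definition Ric2 where
  "Ric2 w = Re (\<Sum>k\<in>UNIV. \<Sum>l\<in>UNIV. G k l w * ip (db l dV) (db k dV) w)"
definition rho where
  "rho a w = Re (ip a (\<lambda>j w. \<Sum>p\<in>UNIV. \<Sum>r\<in>UNIV. a p w * G p r w * dzbar r (dz j V) w) w)"

lemma dV_smooth: "smooth_complex (dV i)"
  by (simp add: dV_def smooth_dz V_smooth)

lemma Psi_eq: "ip dV dV w = complex_of_real (Psi F w)"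
proof -
  have "Psi F w = Re (ip dV dV w)"
    unfolding Psi_def ip_def dV_def V_def[symmetric] inv_hess_eq cnj_dz_V ..
  then show ?thesis using ip_self_real by metis
qed

lemma Psi_nonneg: "Psi F w \<ge> 0"
  using ip_self_nonneg[of dV w] by (simp add: Psi_eq)

lemma cnj_V_mixed: "cnj (dzbar r (dz j V) w) = dzbar j (dz r V) w"
proof -
  have "(\<lambda>w. cnj (dz j V w)) = dzbar j V" by (auto simp: cnj_dz_V)
  then have "dz r (dzbar j V) = (\<lambda>w. cnj (dzbar r (dz j V) w))"
    using dz_cnj[OF smooth_dz[OF V_smooth], of r j] by simp
  then show ?thesis using dz_dzbar_commute[OF V_smooth, of r j] by metis
qed

lemma L_V: "L V w = - complex_of_real (scalar_curvature F w)"
proof -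
  have "cnj (L V w) = L V w"
    by (simp add: L_def cnj_G dz_dzbar_commute V_smooth cnj_V_mixed sum_2)
  then have "L V w = complex_of_real (Re (L V w))" by (simp add: complex_eq_iff)
  then show ?thesis
    by (simp add: scalar_curvature_def Box_eq flip: V_def)
qed

text \<open>The divergence of ddbar V is the gradient of its trace: third derivatives commute and
  the Christoffel symbols are symmetric, so the index of \<nabla> can be exchanged with i.\<close>

lemma divergence_mixed:
  "(\<Sum>k\<in>UNIV. \<Sum>l\<in>UNIV. G k l w * nab k (db l dV) i w) = dz i (L V) w"
proof -
  have c: "dz k (dzbar l (dz i V)) = dz i (dz k (dzbar l V))" for k l
    using dz_dzbar_commute[OF V_smooth] dz_dz_commute[OF smooth_dzbar[OF V_smooth]] by metis
  have c': "dzbar l (dz p V) = dz p (dzbar l V)" for l p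
    by (simp add: dz_dzbar_commute V_smooth)
  have "dz i (L V) w = (\<Sum>k\<in>UNIV. \<Sum>l\<in>UNIV. (\<Sum>m\<in>UNIV. Chr m k i w * G m l w) * dz k (dzbar l V) w
     + G k l w * dz i (dz k (dzbar l V)) w)"
    unfolding L_def
    by (simp add: dz_sum dz_mult G_smooth V_smooth smooth_sum smooth_mult smooth_dz smooth_dzbar dz_G Chr_sym[of i])
  then show ?thesis
    by (simp add: nab_def db_def dV_def c sum_2 algebra_simps) (simp add: c' algebra_simps)
qed

lemma smooth_L: "smooth_complex u \<Longrightarrow> smooth_complex (L u)"
  unfolding L_def by (intro smooth_sum smooth_mult G_smooth smooth_dz smooth_dzbar)

section \<open>Lower bound for the Laplacian of P\<close>

definition gP where "gP \<kappa> \<alpha> w = complex_of_real \<kappa> * exp (complex_of_real \<alpha> * V w) + V w / 2"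

lemma exp_alpha_V: "exp (complex_of_real \<alpha> * V w) = complex_of_real (detW F w powr \<alpha>)"
proof -
  have "complex_of_real \<alpha> * V w = complex_of_real (\<alpha> * ln (detW F w))"
    by (simp add: V_def logV_def)
  then show ?thesis using W_pos[of w] by (simp only: exp_of_real) (simp add: powr_def detW_eq)
qed

lemma detW_pos: "detW F w > 0"
  by (simp add: detW_eq W_pos)

lemma exp_half_V: "exp (V w / 2) = complex_of_real (sqrt (detW F w))"
  using exp_alpha_V[of "1/2" w] detW_pos[of w] by (simp add: powr_half_sqrt)

lemma gP_smooth: "smooth_complex (gP \<kappa> \<alpha>)"
  unfolding gP_def[abs_def] by (intro smooth_add smooth_mult smooth_exp smooth_const V_smooth smooth_divide_const)

lemma cnj_gP: "cnj (gP \<kappa> \<alpha> w) = gP \<kappa> \<alpha> w"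
  by (simp add: gP_def exp_alpha_V) (simp add: V_def)

lemma P_fun_eq: "complex_of_real (P_fun \<kappa> \<alpha> F w) = exp (gP \<kappa> \<alpha> w) * ip dV dV w"
  by (simp add: P_fun_def gP_def exp_add exp_alpha_V exp_half_V Psi_eq exp_of_real flip: of_real_mult)

lemma exp_gP: "exp (gP \<kappa> \<alpha> w) = complex_of_real (exp (\<kappa> * detW F w powr \<alpha>) * sqrt (detW F w))"
  by (simp add: gP_def exp_add exp_alpha_V exp_half_V exp_of_real flip: of_real_mult)

lemma dz_half_V: "dz k (\<lambda>w. V w / 2) = (\<lambda>w. dz k V w / 2)" "dzbar k (\<lambda>w. V w / 2) = (\<lambda>w. dzbar k V w / 2)"
  using dz_mult[OF V_smooth smooth_const[of "1/2"], of k] dzbar_mult[OF V_smooth smooth_const[of "1/2"], of k] by simp_all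

lemma dz_gP: "dz k (gP \<kappa> \<alpha>) = (\<lambda>w. complex_of_real (\<kappa> * \<alpha> * detW F w powr \<alpha> + 1/2) * dz k V w)"
  and dzbar_gP: "dzbar k (gP \<kappa> \<alpha>) = (\<lambda>w. (complex_of_real (\<kappa> * \<alpha>) * exp (complex_of_real \<alpha> * V w) + 1/2) * dzbar k V w)"
  unfolding gP_def[abs_def]
  by (simp_all add: dz_add dz_mult dz_exp dzbar_add dzbar_mult dzbar_exp smooth_mult smooth_exp V_smooth smooth_divide_const dz_half_V)
    (simp_all add: exp_alpha_V algebra_simps)

lemma dz_dzbar_gP: "dz k (dzbar l (gP \<kappa> \<alpha>)) w =
   complex_of_real (\<kappa> * \<alpha> * detW F w powr \<alpha> + 1/2) * dz k (dzbar l V) w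
   + complex_of_real (\<kappa> * \<alpha>\<^sup>2 * detW F w powr \<alpha>) * (dz k V w * dzbar l V w)"
  unfolding dzbar_gP
  by (simp add: dz_add dz_mult dz_exp smooth_add smooth_mult smooth_exp V_smooth smooth_dzbar)
    (simp add: exp_alpha_V power2_eq_square algebra_simps)

text \<open>The second derivative of W^\<alpha> with respect to V produces \<kappa> \<alpha>^2
  W^\<alpha> \<Psi>. Multiplied by \<Psi> it becomes the good quadratic term of P.\<close>

lemma L_gP: "L (gP \<kappa> \<alpha>) w = complex_of_real
   (- (\<kappa> * \<alpha> * detW F w powr \<alpha> + 1/2) * scalar_curvature F w + \<kappa> * \<alpha>\<^sup>2 * detW F w powr \<alpha> * Psi F w)"
proof -
  have "L (gP \<kappa> \<alpha>) w = complex_of_real (\<kappa> * \<alpha> * detW F w powr \<alpha> + 1/2) * L V w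
     + complex_of_real (\<kappa> * \<alpha>\<^sup>2 * detW F w powr \<alpha>) * ip dV dV w"
    unfolding L_def dz_dzbar_gP by (simp add: ip_def dV_def cnj_dz_V sum_2 algebra_simps)
  then show ?thesis by (simp add: L_V Psi_eq algebra_simps)
qed

text \<open>The twist \<open>dz k (gP \<kappa> \<alpha>)\<close> is a multiple of
  \<open>dz k V\<close>. Its share of the trace term is therefore again the Ricci term, which makes
  a cancellation possible.\<close>

lemma rho_dV: "(\<Sum>k\<in>UNIV. \<Sum>l\<in>UNIV. G k l w * (dz k V w * ip (db l dV) dV w))
   = ip dV (\<lambda>j w. \<Sum>p\<in>UNIV. \<Sum>r\<in>UNIV. dV p w * G p r w * dzbar r (dz j V) w) w"
  by (simp add: ip_def dV_def db_def cnj_dz_V cnj_V_mixed cnj_G sum_2 algebra_simps)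

lemma Box_P:
  fixes \<kappa> \<alpha> :: real and w
  defines "x \<equiv> detW F w powr \<alpha>"
  shows "Box F (P_fun \<kappa> \<alpha> F) w \<ge> exp (\<kappa> * x) * sqrt (detW F w) *
    (Ric2 w + 2 * \<kappa> * \<alpha> * x * rho dV w + 2 * Re (ip (\<lambda>i. dz i (L V)) dV w)
     + (- (\<kappa> * \<alpha> * x + 1/2) * scalar_curvature F w + \<kappa> * \<alpha>\<^sup>2 * x * Psi F w) * Psi F w)"
proof -
  \<comment> \<open>The factor with which the differential of \<open>gP\<close> is a multiple of
    that of V. The trace terms contribute 2 \<beta> Re R and the Ricci term - Re R; since 2 \<beta>
    - 1 = 2 \<kappa> \<alpha> x, the summand 1/2 removes the Ricci term.\<close>
  define \<beta> where "\<beta> = \<kappa> * \<alpha> * x + 1/2"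
  define R where "R = ip dV (\<lambda>j w. \<Sum>p\<in>UNIV. \<Sum>r\<in>UNIV. dV p w * G p r w * dzbar r (dz j V) w) w"
  define D where "D = ip (\<lambda>i. dz i (L V)) dV w"
  have t3: "(\<Sum>k\<in>UNIV. \<Sum>l\<in>UNIV. G k l w * ip (tw (gP \<kappa> \<alpha>) k (db l dV)) dV w) = D + complex_of_real \<beta> * R"
  proof -
    have "D = (\<Sum>k\<in>UNIV. \<Sum>l\<in>UNIV. G k l w * ip (nab k (db l dV)) dV w)"
      unfolding D_def ip_def divergence_mixed[symmetric] by (simp add: sum_2 algebra_simps)
    then show ?thesis
      unfolding R_def rho_dV[symmetric] tw_def ip_add_left ip_scale_left
      by (simp add: dz_gP \<beta>_def x_def sum_2 algebra_simps)
  qed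
  have t4: "(\<Sum>k\<in>UNIV. \<Sum>l\<in>UNIV. G k l w * ip dV (tw (gP \<kappa> \<alpha>) l (db k dV)) w) = cnj (D + complex_of_real \<beta> * R)"
    unfolding t3[symmetric] by (simp add: cnj_ip cnj_G sum_2)
  define t1 where "t1 = (\<Sum>k\<in>UNIV. \<Sum>l\<in>UNIV. G k l w * ip (tw (gP \<kappa> \<alpha>) k dV) (tw (gP \<kappa> \<alpha>) l dV) w)"
  define t2 where "t2 = (\<Sum>k\<in>UNIV. \<Sum>l\<in>UNIV. G k l w * ip (db l dV) (db k dV) w)"
  have "Box F (P_fun \<kappa> \<alpha> F) w = Re (L (\<lambda>w. exp (gP \<kappa> \<alpha> w) * ip dV dV w) w)"
    unfolding Box_eq P_fun_eq ..
  also have "\<dots> = exp (\<kappa> * x) * sqrt (detW F w) *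
     (Re t1 + Ric2 w
      + 2 * Re (D + complex_of_real \<beta> * R) + (- \<beta> * scalar_curvature F w + \<kappa> * \<alpha>\<^sup>2 * x * Psi F w) * Psi F w - Re R)"
    apply (subst L_twisted[OF dV_smooth gP_smooth cnj_gP])
    unfolding t3 t4 exp_gP L_gP Psi_eq R_def[symmetric] Ric2_def t1_def[symmetric] t2_def[symmetric] \<beta>_def x_def
    by (simp add: algebra_simps)
  also have "\<dots> \<ge> exp (\<kappa> * x) * sqrt (detW F w) *
     (Ric2 w + 2 * Re (D + complex_of_real \<beta> * R) + (- \<beta> * scalar_curvature F w + \<kappa> * \<alpha>\<^sup>2 * x * Psi F w) * Psi F w - Re R)"
    using tensor_nonneg[of w "\<lambda>k. tw (gP \<kappa> \<alpha>) k dV"] detW_pos[of w]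
    unfolding t1_def by (intro mult_left_mono) auto
  finally show ?thesis
    by (simp add: \<beta>_def R_def D_def rho_def algebra_simps)
qed

section \<open>Lower bound for the Laplacian of Q\<close>

definition gQ where "gQ N1 A w = complex_of_real N1 * ((\<Sum>i\<in>UNIV. w $ i * cnj (w $ i)) - complex_of_real A) + V w / 2"

text \<open>The coefficients of the form dz_m. T is the sum of the squared norms of dz_1 and dz_2,
  so the Bochner formula applies to each summand of Q.\<close>

definition cst :: "2 \<Rightarrow> 2 \<Rightarrow> complex ^ 2 \<Rightarrow> complex" where "cst m i = (\<lambda>w. if i = m then 1 else 0)"

lemma norm_sq_eq: "(\<Sum>i\<in>UNIV. w $ i * cnj (w $ i)) = complex_of_real ((norm (w :: complex ^ 2))\<^sup>2)"
proof -
  have "(norm w)\<^sup>2 = (\<Sum>i\<in>UNIV. (norm (w $ i))\<^sup>2)"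
    by (simp add: norm_vec_def L2_set_def sum_nonneg)
  then show ?thesis by (simp only: of_real_sum complex_norm_square)
qed

lemma gQ_smooth: "smooth_complex (gQ N1 A)"
  unfolding gQ_def[abs_def]
  by (intro smooth_add smooth_diff smooth_mult smooth_sum smooth_cnj smooth_const V_smooth smooth_divide_const smooth_nth)

lemma cnj_gQ: "cnj (gQ N1 A w) = gQ N1 A w"
  unfolding gQ_def norm_sq_eq by (simp add: V_def)

lemma exp_gQ: "exp (gQ N1 A w) = complex_of_real (exp (N1 * ((norm w)\<^sup>2 - A)) * sqrt (detW F w))"
proof -
  have "exp (complex_of_real N1 * (complex_of_real ((norm w)\<^sup>2) - complex_of_real A)) = complex_of_real (exp (N1 * ((norm w)\<^sup>2 - A)))"
    by (simp flip: exp_of_real)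
  then show ?thesis unfolding gQ_def norm_sq_eq exp_add exp_half_V by simp
qed

lemma ip_cst: "ip (cst m) (cst m) w = G m m w"
  using exhaust_2[of m] by (auto simp: ip_def cst_def sum_2)

lemma trT_eq: "(\<Sum>m\<in>UNIV. G m m w) = complex_of_real (trT F w)"
proof -
  have "cnj (\<Sum>m\<in>UNIV. G m m w) = (\<Sum>m\<in>UNIV. G m m w)" by (simp add: cnj_G)
  then have "(\<Sum>m\<in>UNIV. G m m w) = complex_of_real (Re (\<Sum>m\<in>UNIV. G m m w))"
    by (metis Reals_cnj_iff of_real_Re)
  then show ?thesis by (simp add: trT_def inv_hess_eq)
qed

lemma Q_fun_eq: "complex_of_real (Q_fun N1 A F w) = (\<Sum>m\<in>UNIV. exp (gQ N1 A w) * ip (cst m) (cst m) w)"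
  unfolding ip_cst sum_distrib_left[symmetric] trT_eq exp_gQ by (simp add: Q_fun_def)

lemma dz_dzbar_gQ: "dz k (dzbar l (gQ N1 A)) w = (if k = l then complex_of_real N1 else 0) + dz k (dzbar l V) w / 2"
proof -
  have h: "dz k (\<lambda>w. dzbar l V w / 2) = (\<lambda>w. dz k (dzbar l V) w / 2)"
    using dz_mult[OF smooth_dzbar[OF V_smooth] smooth_const[of "1/2"], of k l] by simp
  have "dzbar l (gQ N1 A) = (\<lambda>w. complex_of_real N1 * w $ l + dzbar l V w / 2)"
    unfolding gQ_def[abs_def] using exhaust_2[of l]
    by (auto simp: sum_2 dzbar_add dzbar_diff dzbar_mult dzbar_cnj dz_nth dzbar_nth smooth_mult smooth_add smooth_diff smooth_cnj
      smooth_divide_const V_smooth dz_half_V)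
  then show ?thesis
    by (simp add: dz_add dz_mult h dz_nth smooth_mult smooth_divide_const smooth_dzbar V_smooth)
qed

lemma L_gQ: "L (gQ N1 A) w = complex_of_real (N1 * trT F w - scalar_curvature F w / 2)"
proof -
  have "L (gQ N1 A) w = complex_of_real N1 * (\<Sum>m\<in>UNIV. G m m w) + L V w / 2"
    unfolding L_def dz_dzbar_gQ by (simp add: sum_2 algebra_simps add_divide_distrib)
  then show ?thesis by (simp add: L_V trT_eq)
qed

lemma L_sum: "(\<And>m. smooth_complex (u m)) \<Longrightarrow> L (\<lambda>w. \<Sum>m\<in>(UNIV::2 set). u m w) w = (\<Sum>m\<in>UNIV. L (u m) w)"
  unfolding L_def by (simp add: dzbar_sum dz_sum smooth_dzbar smooth_sum) (simp add: sum_2 algebra_simps)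

lemma cst_smooth: "smooth_complex (cst m i)"
  by (simp add: cst_def)

text \<open>The forms dz_m are holomorphic, so all terms with \<open>db\<close> vanish. In
  \<open>L_gQ\<close> the Laplacian of |z|^2 is T, which gives N1 T^2, and V/2 gives - S T / 2.
  Nothing cancels the Ricci term here.\<close>

lemma Box_Q: "Box F (Q_fun N1 A F) w \<ge> exp (N1 * ((norm w)\<^sup>2 - A)) * sqrt (detW F w) *
    (N1 * (trT F w)\<^sup>2 - scalar_curvature F w / 2 * trT F w - (\<Sum>m\<in>UNIV. rho (cst m) w))"
proof -
  define e where "e = exp (N1 * ((norm w)\<^sup>2 - A)) * sqrt (detW F w)"
  have e: "e > 0" using detW_pos by (simp add: e_def)
  have z: "db l (cst m) = (\<lambda>i w. 0)" for l m
    by (auto simp: db_def cst_def)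
  have tz: "tw g k (\<lambda>i w. 0) = (\<lambda>i w. 0)" for g k
    by (simp add: tw_def nab_def fun_eq_iff)
  have ipz: "ip (\<lambda>i w. 0) c w = 0" "ip c (\<lambda>i w. 0) w = 0" for c
    by (simp_all add: ip_def)
  have 1: "Re (L (\<lambda>w. exp (gQ N1 A w) * ip (cst m) (cst m) w) w)
     \<ge> e * ((N1 * trT F w - scalar_curvature F w / 2) * Re (G m m w) - rho (cst m) w)" for m
  proof -
    define t1 where "t1 = (\<Sum>k\<in>UNIV. \<Sum>l\<in>UNIV. G k l w * ip (tw (gQ N1 A) k (cst m)) (tw (gQ N1 A) l (cst m)) w)"
    have "L (\<lambda>w. exp (gQ N1 A w) * ip (cst m) (cst m) w) w
      = complex_of_real e * (t1 + complex_of_real (N1 * trT F w - scalar_curvature F w / 2) * G m m w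
         - ip (cst m) (\<lambda>j w. \<Sum>p\<in>UNIV. \<Sum>r\<in>UNIV. cst m p w * G p r w * dzbar r (dz j V) w) w)"
      apply (subst L_twisted[OF cst_smooth gQ_smooth cnj_gQ])
      unfolding exp_gQ L_gQ ip_cst z tz ipz e_def[symmetric] t1_def[symmetric]
      by simp
    then have "Re (L (\<lambda>w. exp (gQ N1 A w) * ip (cst m) (cst m) w) w)
      = e * (Re t1 + (N1 * trT F w - scalar_curvature F w / 2) * Re (G m m w) - rho (cst m) w)"
      by (simp add: rho_def)
    then show ?thesis
      using tensor_nonneg[of w "\<lambda>k. tw (gQ N1 A) k (cst m)"] e by (simp add: t1_def)
  qed
  have "Box F (Q_fun N1 A F) w = (\<Sum>m\<in>UNIV. Re (L (\<lambda>w. exp (gQ N1 A w) * ip (cst m) (cst m) w) w))"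
    unfolding Box_eq Q_fun_eq
    by (subst L_sum) (auto intro!: smooth_mult smooth_exp gQ_smooth ip_smooth cst_smooth)
  also have "\<dots> \<ge> (\<Sum>m\<in>UNIV. e * ((N1 * trT F w - scalar_curvature F w / 2) * Re (G m m w) - rho (cst m) w))"
    by (intro sum_mono 1)
  also have "(\<Sum>m\<in>UNIV. e * ((N1 * trT F w - scalar_curvature F w / 2) * Re (G m m w) - rho (cst m) w))
    = e * ((N1 * trT F w - scalar_curvature F w / 2) * Re (\<Sum>m\<in>UNIV. G m m w) - (\<Sum>m\<in>UNIV. rho (cst m) w))"
    by (simp add: sum_2 algebra_simps)
  finally show ?thesis unfolding trT_eq e_def by (simp add: power2_eq_square algebra_simps)
qed

text \<open>Expansion of the squared norm of ddbar V + d (\<partial>V \<otimes> dbar V).\<close>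

lemma Ric2_rho_dV: "Ric2 w + 2 * d * rho dV w + d\<^sup>2 * (Psi F w)\<^sup>2 \<ge> 0"
proof -
  define X where "X l i = (\<lambda>w. db l dV i w + complex_of_real d * (dz i V w * dzbar l V w))" for l i
  have "(\<Sum>k\<in>UNIV. \<Sum>l\<in>UNIV. G k l w * ip (X l) (X k) w)
    = (\<Sum>k\<in>UNIV. \<Sum>l\<in>UNIV. G k l w * ip (db l dV) (db k dV) w)
    + complex_of_real d * (\<Sum>k\<in>UNIV. \<Sum>l\<in>UNIV. G k l w * (dz k V w * ip (db l dV) dV w))
    + complex_of_real d * cnj (\<Sum>k\<in>UNIV. \<Sum>l\<in>UNIV. G k l w * (dz k V w * ip (db l dV) dV w))
    + (complex_of_real d)\<^sup>2 * (ip dV dV w * ip dV dV w)"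
    by (simp add: X_def ip_def sum_2 dV_def cnj_dz_V cnj_dzbar_V cnj_G power2_eq_square algebra_simps)
  then have "Re (\<Sum>k\<in>UNIV. \<Sum>l\<in>UNIV. G k l w * ip (X l) (X k) w) = Ric2 w + 2 * d * rho dV w + d\<^sup>2 * (Psi F w)\<^sup>2"
    unfolding rho_dV Psi_eq by (simp add: Ric2_def rho_def power2_eq_square)
  then show ?thesis using tensor_nonneg'[of w X] by simp
qed

text \<open>A quarter of the squared norm of ddbar V - 2 \<delta>, where \<delta> is the Euclidean
  form. The squared norm of \<delta> is tr (G G), and T^2 exceeds it by 2 det G > 0.\<close>

lemma Ric2_rho_cst: "Ric2 w / 4 - (\<Sum>m\<in>UNIV. rho (cst m) w) + (trT F w)\<^sup>2 \<ge> 0"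
proof -
  define X where "X l i = (\<lambda>w. db l dV i w + (if l = i then - 2 else 0))" for l i
  define Z where "Z = (\<Sum>m\<in>UNIV. ip (cst m) (\<lambda>j w. \<Sum>p\<in>UNIV. \<Sum>r\<in>UNIV. cst m p w * G p r w * dzbar r (dz j V) w) w)"
  define Y where "Y = (\<Sum>k\<in>UNIV. \<Sum>l\<in>UNIV. G k l w * G l k w)"
  have "(\<Sum>k\<in>UNIV. \<Sum>l\<in>UNIV. G k l w * ip (X l) (X k) w)
    = (\<Sum>k\<in>UNIV. \<Sum>l\<in>UNIV. G k l w * ip (db l dV) (db k dV) w) - 2 * Z - 2 * cnj Z + 4 * Y"
    by (simp add: X_def Y_def Z_def ip_def db_def dV_def cst_def sum_2 cnj_G cnj_V_mixed algebra_simps)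
  then have "Re (\<Sum>k\<in>UNIV. \<Sum>l\<in>UNIV. G k l w * ip (X l) (X k) w)
     = Ric2 w - 4 * (\<Sum>m\<in>UNIV. rho (cst m) w) + 4 * Re Y"
    by (simp add: Ric2_def rho_def Z_def)
  then have 1: "Ric2 w - 4 * (\<Sum>m\<in>UNIV. rho (cst m) w) + 4 * Re Y \<ge> 0"
    using tensor_nonneg'[of w X] by simp
  have "(\<Sum>m\<in>UNIV. G m m w)\<^sup>2 - Y = 2 * (G 1 1 w * G 2 2 w - G 1 2 w * G 2 1 w)"
    by (simp add: Y_def sum_2 power2_eq_square algebra_simps)
  also have "G 1 1 w * G 2 2 w - G 1 2 w * G 2 1 w = W w * inverse (W w) * inverse (W w)"
    unfolding G_explicit by (simp add: W_def algebra_simps)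
  also have "\<dots> = complex_of_real (inverse (Re (W w)))"
    using W_real[of w] W_nonzero[of w] by (metis of_real_inverse mult.left_neutral right_inverse)
  finally have "(trT F w)\<^sup>2 - Re Y = 2 * inverse (Re (W w))"
    unfolding trT_eq by (metis (no_types) Re_complex_of_real minus_complex.simps(1) of_real_mult of_real_numeral of_real_power)
  then have "(trT F w)\<^sup>2 \<ge> Re Y"
    using W_pos[of w] by (smt (verit) inverse_positive_iff_positive)
  with 1 show ?thesis by simp
qed

end

subsection \<open>Torus invariance and the moment map\<close>

lemma frechet_expand:
  fixes g :: "complex ^ 2 \<Rightarrow> complex"
  assumes "g differentiable (at z)"
  shows "frechet_derivative g (at z) v = (\<Sum>k\<in>UNIV. dz k g z * v $ k + dzbar k g z * cnj (v $ k))"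
proof -
  have lin: "linear (frechet_derivative g (at z))"
    using assms linear_frechet_derivative by blast
  have v: "v = (\<Sum>k\<in>UNIV. Re (v $ k) *\<^sub>R axis k 1 + Im (v $ k) *\<^sub>R axis k \<i>)"
    by (auto simp: vec_eq_iff sum_2 axis_def forall_2 complex_eq_iff)
  have "frechet_derivative g (at z) v = (\<Sum>k\<in>UNIV. Re (v $ k) *\<^sub>R frechet_derivative g (at z) (axis k 1)
     + Im (v $ k) *\<^sub>R frechet_derivative g (at z) (axis k \<i>))"
    by (subst v) (simp add: linear_sum[OF lin] linear_add[OF lin] linear_cmul[OF lin])
  also have "\<dots> = (\<Sum>k\<in>UNIV. dz k g z * v $ k + dzbar k g z * cnj (v $ k))"
    unfolding frechet_axis_one frechet_axis_ii
    by (intro sum.cong refl) (auto simp: complex_eq_iff algebra_simps)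
  finally show ?thesis .
qed

definition torus_act :: "complex ^ 2 \<Rightarrow> complex ^ 2 \<Rightarrow> complex ^ 2" where
  "torus_act t z = (\<chi> i. t $ i * z $ i)"

lemma has_derivative_torus_act: "(torus_act t has_derivative torus_act t) (at z)"
proof -
  have "linear (torus_act t)"
    by (rule linearI) (auto simp: torus_act_def vec_eq_iff algebra_simps)
  then show ?thesis by (intro bounded_linear_imp_has_derivative) (simp add: linear_conv_bounded_linear)
qed

lemma torus_act_axis: "torus_act t (axis i c) = axis i (t $ i * c)"
  by (auto simp: torus_act_def axis_def vec_eq_iff)

lemma
  assumes g: "smooth_complex g"
  shows dz_torus_act: "dz i (\<lambda>w. g (torus_act t w)) z = t $ i * dz i g (torus_act t z)"
    and dzbar_torus_act: "dzbar i (\<lambda>w. g (torus_act t w)) z = cnj (t $ i) * dzbar i g (torus_act t z)"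
proof -
  have e: "((\<lambda>w. g (torus_act t w)) has_derivative (\<lambda>v. frechet_derivative g (at (torus_act t z)) (torus_act t v))) (at z)"
    using has_derivative_compose[OF has_derivative_torus_act smooth_has_derivative[OF g]] .
  note x = frechet_expand[OF smooth_differentiable[OF g]]
  have a: "(\<Sum>k\<in>UNIV. f k * (axis i c :: complex^2) $ k + f' k * cnj ((axis i c :: complex^2) $ k)) = f i * c + f' i * cnj c" for f f' c
    using exhaust_2[of i] by (auto simp: sum_2 axis_def)
  show "dz i (\<lambda>w. g (torus_act t w)) z = t $ i * dz i g (torus_act t z)"
    "dzbar i (\<lambda>w. g (torus_act t w)) z = cnj (t $ i) * dzbar i g (torus_act t z)"
    unfolding dz_eq[OF e] dzbar_eq[OF e] torus_act_axis x a by (simp_all add: algebra_simps)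
qed

lemma ctorus_dense: "z islimpt ctorus"
  unfolding islimpt_approachable
proof (intro allI impI)
  fix e :: real assume e: "e > 0"
  have "infinite {0<..<e/2}" using e by (simp add: infinite_Ioo)
  then obtain d where d: "d \<in> {0<..<e/2}" "complex_of_real d \<noteq> - z $ 1" "complex_of_real d \<noteq> - z $ 2"
  proof -
    have "finite ({0<..<e/2} \<inter> {Re (- z $ 1), Re (- z $ 2)})" by blast
    then have "infinite ({0<..<e/2} - {Re (- z $ 1), Re (- z $ 2)})"
      using \<open>infinite {0<..<e/2}\<close> by (simp add: Diff_infinite_finite)
    then obtain d where "d \<in> {0<..<e/2} - {Re (- z $ 1), Re (- z $ 2)}"
      using infinite_imp_nonempty by blast
    then show ?thesis using that[of d] by (auto simp: complex_eq_iff)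
  qed
  define w where "w = z + (\<chi> i. complex_of_real d)"
  have "w $ i \<noteq> 0" for i
    using d exhaust_2[of i] by (auto simp: w_def add_eq_0_iff add.commute)
  then have "w \<in> ctorus" by (simp add: ctorus_def)
  moreover have "w \<noteq> z" using d by (auto simp: w_def vec_eq_iff)
  moreover have "dist w z < e"
  proof -
    have "dist w z = norm (\<chi> i::2. complex_of_real d)" by (simp add: w_def dist_norm)
    also have "\<dots> \<le> (\<Sum>i\<in>(UNIV::2 set). norm ((\<chi> i. complex_of_real d) $ i))" unfolding norm_vec_def by (rule L2_set_le_sum) simp
    also have "\<dots> < e" using d by (simp add: sum_2)
    finally show ?thesis .
  qed
  ultimately show "\<exists>x'\<in>ctorus. x' \<noteq> z \<and> dist x' z < e" by blast
qed

lemma open_ctorus: "open ctorus"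
proof -
  have "ctorus = {z. z $ 1 \<noteq> 0} \<inter> {z. z $ 2 \<noteq> 0}" by (auto simp: ctorus_def)
  moreover have "open \<dots>"
    by (intro open_Int open_Collect_neq continuous_intros)
  ultimately show ?thesis by simp
qed

lemma closure_ctorus: "closure ctorus = UNIV"
  using ctorus_dense by (auto simp: closure_def)

lemma eq_on_ctorus_imp_eq:
  fixes f g :: "complex ^ 2 \<Rightarrow> 'a::t2_space"
  assumes "continuous_on UNIV f" "continuous_on UNIV g" "\<And>z. z \<in> ctorus \<Longrightarrow> f z = g z"
  shows "f z = g z"
proof -
  have "closed {z. f z = g z}"
    using assms by (intro closed_Collect_eq)
  then have "closure ctorus \<subseteq> {z. f z = g z}"
    using assms(3) by (intro closure_minimal) auto
  then show ?thesis by (auto simp: closure_ctorus)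
qed

section \<open>Logarithmic coordinates and torus invariance\<close>

definition moduli :: "complex ^ 2 \<Rightarrow> complex ^ 2" where
  "moduli z = (\<chi> i. complex_of_real (cmod (z $ i)))"

definition exp_half :: "real ^ 2 \<Rightarrow> complex ^ 2" where
  "exp_half x = (\<chi> i. complex_of_real (exp (x $ i / 2)))"

lemma exp_half_ctorus: "exp_half x \<in> ctorus"
  by (simp add: ctorus_def exp_half_def)

lemma ctorus_nonzero: "z \<in> ctorus \<Longrightarrow> z $ i \<noteq> 0"
  using exhaust_2[of i] by (auto simp: ctorus_def)

lemma log_coords_exp_half: "log_coords (exp_half x) = x"
proof -
  have "ln ((exp (x $ i / 2))\<^sup>2) = x $ i" for i
    by (simp flip: exp_of_nat_mult)
  then show ?thesis by (simp add: log_coords_def exp_half_def vec_eq_iff)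
qed

lemma exp_half_log_coords:
  assumes "z \<in> ctorus"
  shows "exp_half (log_coords z) = moduli z"
proof -
  have "exp (ln ((cmod (z $ i))\<^sup>2) / 2) = cmod (z $ i)" for i
    using ctorus_nonzero[OF assms] by (simp add: ln_realpow)
  then show ?thesis by (simp add: log_coords_def exp_half_def moduli_def vec_eq_iff)
qed

text \<open>The rotation divides out the phases; a vanishing coordinate has no phase and gets the
  factor 1.\<close>

lemma moduli_act:
  obtains t where "\<And>i. cmod (t $ i) = 1" "moduli z = torus_act t z"
proof
  show "cmod ((\<chi> i. if z $ i = 0 then 1 else complex_of_real (cmod (z $ i)) / z $ i) $ i) = 1" for i
    by (simp add: norm_divide)
  show "moduli z = torus_act (\<chi> i. if z $ i = 0 then 1 else complex_of_real (cmod (z $ i)) / z $ i) z"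
    by (auto simp: moduli_def torus_act_def vec_eq_iff)
qed

locale toric_kahler = kahler F for F +
  fixes f :: "real ^ 2 \<Rightarrow> real"
  assumes F_f: "\<And>z. z \<in> ctorus \<Longrightarrow> F z = f (log_coords z)"
begin

lemma F_continuous: "continuous_on UNIV F"
  using smooth_continuous[OF Fc_smooth] continuous_on_Re[of UNIV Fc] by (simp add: Fc_def)

lemma F_moduli: "F z = F (moduli z)"
proof (rule eq_on_ctorus_imp_eq[of F "\<lambda>z. F (moduli z)"])
  show "continuous_on UNIV F" by (rule F_continuous)
  have "continuous_on UNIV moduli" unfolding moduli_def by (intro continuous_intros)
  then show "continuous_on UNIV (\<lambda>z. F (moduli z))"
    using continuous_on_compose2[OF F_continuous] by blast
  fix z assume z: "z \<in> ctorus"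
  then have "moduli z \<in> ctorus" "log_coords (moduli z) = log_coords z"
    by (auto simp: ctorus_def moduli_def log_coords_def)
  then show "F z = F (moduli z)" using z F_f by metis
qed

context
  fixes t :: "complex ^ 2" assumes t: "\<And>i. cmod (t $ i) = 1"
begin

lemma cnj_t: "t $ i * cnj (t $ i) = 1"
  using complex_norm_square[of "t $ i"] t by simp

lemma F_act: "F (torus_act t z) = F z"
proof -
  have "moduli (torus_act t z) = moduli z"
    using t by (simp add: moduli_def torus_act_def norm_mult)
  then show ?thesis using F_moduli by metis
qed

lemma dzbar_Fc_act: "dzbar i Fc z = cnj (t $ i) * dzbar i Fc (torus_act t z)"
  using dzbar_torus_act[OF Fc_smooth, of i t z] by (simp add: Fc_def F_act)

lemma h_act: "h i j z = t $ i * cnj (t $ j) * h i j (torus_act t z)"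
proof -
  have "dzbar j Fc = (\<lambda>z. cnj (t $ j) * dzbar j Fc (torus_act t z))"
    using dzbar_Fc_act by blast
  then have "h i j z = dz i (\<lambda>z. cnj (t $ j) * dzbar j Fc (torus_act t z)) z"
    by (simp add: h_def)
  \<comment> \<open>Equivariance itself exhibits the pullback as a constant multiple of the smooth
    function \<open>dzbar j Fc\<close>.\<close>
  moreover have "smooth_complex (\<lambda>z. dzbar j Fc (torus_act t z))"
  proof -
    have "(\<lambda>z. dzbar j Fc (torus_act t z)) = (\<lambda>z. t $ j * dzbar j Fc z)"
      by (rule ext, subst dzbar_Fc_act[of j]) (simp add: mult.assoc[symmetric] cnj_t)
    then show ?thesis by (simp add: smooth_mult smooth_dzbar Fc_smooth)
  qed
  ultimately show ?thesis
    by (simp add: dz_mult dz_torus_act smooth_dzbar Fc_smooth h_def mult.commute mult.left_commute)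
qed

lemma W_act: "W z = W (torus_act t z)"
proof -
  have "W z = (t $ 1 * cnj (t $ 1)) * (t $ 2 * cnj (t $ 2)) * W (torus_act t z)"
    unfolding W_def h_act[of _ _ z] by (simp add: algebra_simps)
  then show ?thesis by (simp add: cnj_t)
qed

lemma V_act: "V (torus_act t z) = V z"
  by (simp add: V_def logV_def detW_eq W_act[symmetric])

lemma V_mixed_act: "dz i (dzbar j V) z = t $ i * cnj (t $ j) * dz i (dzbar j V) (torus_act t z)"
proof -
  have *: "dzbar j V z = cnj (t $ j) * dzbar j V (torus_act t z)" for z j
    using dzbar_torus_act[OF V_smooth, of j t z] by (simp add: V_act)
  have "(\<lambda>z. dzbar j V (torus_act t z)) = (\<lambda>z. t $ j * dzbar j V z)"
    by (rule ext, subst *[of j]) (simp add: mult.assoc[symmetric] cnj_t)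
  then have "smooth_complex (\<lambda>z. dzbar j V (torus_act t z))"
    by (simp add: smooth_mult smooth_dzbar V_smooth)
  moreover have "dz i (dzbar j V) z = dz i (\<lambda>z. cnj (t $ j) * dzbar j V (torus_act t z)) z"
    using * by (metis (no_types))
  ultimately show ?thesis
    by (simp add: dz_mult dz_torus_act smooth_dzbar V_smooth mult.commute mult.left_commute)
qed

lemma G_act: "G i j z = cnj (t $ i) * t $ j * G i j (torus_act t z)"
proof -
  have c: "cnj (t $ i) * t $ i = 1" for i using cnj_t[of i] by (simp add: mult.commute)
  show ?thesis
    using exhaust_2[of i] exhaust_2[of j]
    by (auto simp: G_explicit h_act[of _ _ z] W_act[of z] cnj_t c)
qed

text \<open>The phases acquired by \<open>G\<close> and by the mixed Hessian of V are inverse to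
  each other.\<close>

lemma scalar_curvature_act: "scalar_curvature F (torus_act t z) = scalar_curvature F z"
proof -
  have "G k l z * dz k (dzbar l V) z = G k l (torus_act t z) * dz k (dzbar l V) (torus_act t z)" for k l
  proof -
    have "G k l z * dz k (dzbar l V) z = (t $ k * cnj (t $ k)) * (t $ l * cnj (t $ l)) *
       (G k l (torus_act t z) * dz k (dzbar l V) (torus_act t z))"
      unfolding G_act[of k l z] V_mixed_act[of k l z] by (simp add: algebra_simps)
    then show ?thesis by (simp add: cnj_t)
  qed
  then have "L V (torus_act t z) = L V z" by (simp add: L_def)
  then show ?thesis using L_V by simp
qed

end

text \<open>On torus invariant functions, zbar_i times the derivative along zbar_i is the derivative
  with respect to x_i = log |z_i|^2. This expression for the moment map stays smooth across the
  axes.\<close>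

definition mm where "mm i z = cnj (z $ i) * dzbar i Fc z"

lemma mm_smooth: "smooth_complex (mm i)"
  unfolding mm_def[abs_def] by (intro smooth_mult smooth_cnj smooth_dzbar Fc_smooth smooth_nth)

lemma dz_mm: "dz k (mm i) z = cnj (z $ i) * h k i z"
  unfolding mm_def[abs_def]
  by (simp add: dz_mult dz_cnj smooth_cnj smooth_dzbar Fc_smooth dzbar_nth h_def)

lemma mm_act:
  assumes t: "\<And>i. cmod (t $ i) = 1"
  shows "mm i (torus_act t z) = mm i z"
  using cnj_t[OF t, of i] by (simp add: mm_def dzbar_Fc_act[OF t, of i z] torus_act_def mult_ac)

lemma mm_moduli: "mm i (moduli z) = mm i z"
  using moduli_act mm_act by metis

text \<open>At a point with real coordinates, \<open>F\<close> is even in the imaginary part of each coordinate.\<close>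

lemma mm_real: "mm i z = complex_of_real (Re (mm i z))"
proof -
  define r where "r = moduli z"
  define \<phi> where "\<phi> s = Fc (r + axis i (\<i> * complex_of_real s))" for s
  define p where "p = frechet_derivative Fc (at r) (axis i \<i>)"
  have d1: "(\<phi> has_derivative (\<lambda>s. s *\<^sub>R p)) (at 0)"
  proof -
    have ax: "((\<lambda>s. r + axis i (\<i> * complex_of_real s)) has_derivative (\<lambda>s. s *\<^sub>R axis i \<i>)) (at 0)"
    proof -
      have "(\<lambda>s. r + axis i (\<i> * complex_of_real s)) = (\<lambda>s. r + s *\<^sub>R axis i \<i>)"
        by (simp add: fun_eq_iff vec_eq_iff axis_def scaleR_conv_of_real[where 'a = complex] mult.commute)
      then show ?thesis by (auto intro!: derivative_eq_intros)
    qed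
    have "(Fc has_derivative frechet_derivative Fc (at r)) (at (r + axis i (\<i> * complex_of_real 0)))"
      using smooth_has_derivative[OF Fc_smooth, of r] by (simp add: axis_def vec_lambda_beta flip: zero_vec_def)
    from has_derivative_compose[OF ax this]
    have "(\<phi> has_derivative (\<lambda>s. frechet_derivative Fc (at r) (s *\<^sub>R axis i \<i>))) (at 0)"
      by (simp add: \<phi>_def[abs_def])
    moreover have "linear (frechet_derivative Fc (at r))"
      using smooth_differentiable[OF Fc_smooth] linear_frechet_derivative by blast
    ultimately show ?thesis by (simp add: linear_cmul p_def)
  qed
  have "moduli (r + axis i (\<i> * complex_of_real (- s))) = moduli (r + axis i (\<i> * complex_of_real s))" for s
    by (auto simp: moduli_def r_def axis_def vec_eq_iff cmod_def)
  then have even: "\<phi> (- s) = \<phi> s" for s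
    unfolding \<phi>_def Fc_def using F_moduli by metis
  have "((\<lambda>s. \<phi> (- s)) has_derivative (\<lambda>s. (- s) *\<^sub>R p)) (at 0)"
    by (rule has_derivative_compose[where g = \<phi>]) (auto intro!: derivative_eq_intros d1)
  then have "(\<phi> has_derivative (\<lambda>s. (- s) *\<^sub>R p)) (at 0)" by (simp add: even)
  from has_derivative_unique[OF this d1] have "(- 1) *\<^sub>R p = 1 *\<^sub>R p" by metis
  then have "p = 0" by simp
  then have "dz i Fc r = dzbar i Fc r" by (simp add: p_def frechet_axis_ii)
  then have "cnj (dzbar i Fc r) = dzbar i Fc r" using dz_Fc by (metis complex_cnj_cnj)
  then have "cnj (mm i r) = mm i r"
    by (simp add: mm_def r_def moduli_def)
  then have "cnj (mm i z) = mm i z" by (simp add: r_def mm_moduli)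
  then show ?thesis by (simp add: complex_eq_iff)
qed

lemma dzbar_mm: "dzbar k (mm i) z = cnj (dz k (mm i) z)"
proof -
  have "mm i = (\<lambda>z. cnj (mm i z))"
    using mm_real[of i] by (metis complex_cnj_complex_of_real)
  then show ?thesis using dzbar_cnj[OF mm_smooth, of k i] by metis
qed

lemma frechet_mm: "frechet_derivative (mm i) (at z) v = complex_of_real (2 * Re (\<Sum>k\<in>UNIV. cnj (z $ i) * h k i z * v $ k))"
  unfolding frechet_expand[OF smooth_differentiable[OF mm_smooth]] dzbar_mm dz_mm
  by (simp add: sum_2 complex_eq_iff algebra_simps)

definition mu where "mu z = (\<chi> i. Re (mm i z))"

lemma mu_moduli: "mu (moduli z) = mu z"
  by (simp add: mu_def mm_moduli)

lemma mu_has_derivative: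
  "(mu has_derivative (\<lambda>v. \<chi> i. 2 * Re (\<Sum>k\<in>UNIV. cnj (z $ i) * h k i z * v $ k))) (at z)"
  unfolding has_derivative_componentwise_within[of mu]
proof
  fix b :: "real ^ 2" assume "b \<in> Basis"
  then obtain i where b: "b = axis i 1" by (auto simp: Basis_vec_def)
  have "((\<lambda>z. Re (mm i z)) has_derivative (\<lambda>v. Re (frechet_derivative (mm i) (at z) v))) (at z)"
    by (intro has_derivative_Re smooth_has_derivative mm_smooth)
  then show "((\<lambda>x. mu x \<bullet> b) has_derivative (\<lambda>x. (\<chi> i. 2 * Re (\<Sum>k\<in>UNIV. cnj (z $ i) * h k i z * x $ k)) \<bullet> b)) (at z)"
    by (simp add: b inner_axis mu_def frechet_mm)
qed

lemma mu_continuous: "continuous_on UNIV mu"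
  using mu_has_derivative has_derivative_continuous by (blast intro: continuous_at_imp_continuous_on)

lemma exp_half_has_derivative:
  "(exp_half has_derivative (\<lambda>v. \<chi> i. complex_of_real (exp (x $ i / 2) * (v $ i / 2)))) (at x)"
  unfolding has_derivative_componentwise_within[of exp_half]
proof
  fix b :: "complex ^ 2" assume "b \<in> Basis"
  then obtain i c where b: "b = axis i c" by (auto simp: Basis_vec_def)
  have "((\<lambda>x::real^2. x $ i) has_derivative (\<lambda>v. v $ i)) (at x)"
    by (rule bounded_linear_imp_has_derivative) (rule bounded_linear_vec_nth)
  then have "((\<lambda>x. complex_of_real (exp (x $ i / 2)) \<bullet> c) has_derivative
     (\<lambda>v. complex_of_real (exp (x $ i / 2) * (v $ i / 2)) \<bullet> c)) (at x)"
    by (auto intro!: derivative_eq_intros simp: mult.commute)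
  then show "((\<lambda>x. exp_half x \<bullet> b) has_derivative
     (\<lambda>v. (\<chi> i. complex_of_real (exp (x $ i / 2) * (v $ i / 2))) \<bullet> b)) (at x)"
    by (simp add: b inner_axis exp_half_def)
qed

text \<open>Chain rule through \<open>exp_half\<close>. The factor 1/2 from exp(x/2) is compensated
  by the equal real parts of \<open>dz\<close> and \<open>dzbar\<close>.\<close>

lemma gderiv_f: "GDERIV f x :> mu (exp_half x)"
proof -
  have f: "f = (\<lambda>x. F (exp_half x))"
    using F_f[OF exp_half_ctorus] by (simp add: log_coords_exp_half)
  have "(F has_derivative (\<lambda>v. Re (frechet_derivative Fc (at z) v))) (at z)" for z
    using has_derivative_Re[OF smooth_has_derivative[OF Fc_smooth, of z]] by (simp add: Fc_def)
  from has_derivative_compose[OF exp_half_has_derivative this]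
  have "(f has_derivative (\<lambda>v. Re (frechet_derivative Fc (at (exp_half x))
      (\<chi> i. complex_of_real (exp (x $ i / 2) * (v $ i / 2)))))) (at x)"
    unfolding f .
  moreover have "Re (frechet_derivative Fc (at (exp_half x)) (\<chi> i. complex_of_real (exp (x $ i / 2) * (v $ i / 2))))
      = v \<bullet> mu (exp_half x)" for v
  proof -
    have d: "Re (dz k Fc w) = Re (dzbar k Fc w)" for k w
      using dz_Fc[of k w] by (metis complex_cnj_cnj cnj.simps(1))
    show ?thesis
      unfolding frechet_expand[OF smooth_differentiable[OF Fc_smooth]]
      by (simp add: inner_vec_def mu_def mm_def exp_half_def sum_2 d algebra_simps)
  qed
  ultimately show ?thesis by (simp add: gderiv_def)
qed

lemma grad_f: "grad f x = mu (exp_half x)"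
  unfolding grad_def
proof (rule the_equality)
  show "GDERIV f x :> mu (exp_half x)" by (rule gderiv_f)
next
  fix D assume "GDERIV f x :> D"
  with gderiv_f[of x] have "(\<lambda>v. v \<bullet> D) = (\<lambda>v. v \<bullet> mu (exp_half x))"
    unfolding gderiv_def using has_derivative_unique by blast
  then have "\<forall>v. v \<bullet> D = v \<bullet> mu (exp_half x)" by (simp add: fun_eq_iff)
  then show "D = mu (exp_half x)" by (rule vector_eq_ldot[THEN iffD1])
qed

text \<open>Since \<open>mu\<close> is continuous everywhere and agrees with the gradient of f on
  the dense torus, the limit is its value.\<close>

lemma moment_map_eq: "moment_map f z = mu z"
  unfolding moment_map_def
proof (rule tendsto_Lim)
  show "\<not> trivial_limit (at z within ctorus)"
    using ctorus_dense by (simp add: trivial_limit_within)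
  have "(mu \<longlongrightarrow> mu z) (at z within ctorus)"
    using mu_continuous by (metis UNIV_I continuous_on_def tendsto_within_subset subset_UNIV)
  moreover have "\<forall>\<^sub>F w in at z within ctorus. grad f (log_coords w) = mu w"
    by (auto simp: eventually_at_filter grad_f exp_half_log_coords mu_moduli)
  ultimately show "((\<lambda>w. grad f (log_coords w)) \<longlongrightarrow> mu z) (at z within ctorus)"
    using tendsto_cong by force
qed

text \<open>The i-th component vanishes when z_i = 0 and increases as this coordinate is scaled up
  to its value, because \<open>h i i\<close> is positive.\<close>

lemma mu_pos:
  assumes z: "z \<in> ctorus"
  shows "mu z $ i > 0"
proof -
  define Z where "Z s = (\<chi> j. if j = i then complex_of_real s * z $ i else z $ j)" for s
  define \<psi> where "\<psi> s = Re (mm i (Z s))" for s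
  have Zd: "(Z has_derivative (\<lambda>s. s *\<^sub>R axis i (z $ i))) (at s)" for s
  proof -
    define c where "c = Z 0"
    have e: "Z = (\<lambda>s. c + s *\<^sub>R axis i (z $ i))"
      by (simp add: c_def Z_def fun_eq_iff vec_eq_iff axis_def scaleR_conv_of_real[where 'a = complex])
    show ?thesis unfolding e by (auto intro!: derivative_eq_intros)
  qed
  have "(\<psi> has_real_derivative 2 * s * (cmod (z $ i))\<^sup>2 * Re (h i i (Z s))) (at s)" for s
  proof -
    have "(\<psi> has_derivative (\<lambda>t. Re (frechet_derivative (mm i) (at (Z s)) (t *\<^sub>R axis i (z $ i))))) (at s)"
      unfolding \<psi>_def
      by (intro has_derivative_Re has_derivative_compose[OF Zd] smooth_has_derivative mm_smooth)
    moreover have "Re (frechet_derivative (mm i) (at (Z s)) (t *\<^sub>R axis i (z $ i))) = 2 * s * (cmod (z $ i))\<^sup>2 * Re (h i i (Z s)) * t" for t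
    proof -
      have "(\<Sum>k\<in>UNIV. cnj (Z s $ i) * h k i (Z s) * (t *\<^sub>R axis i (z $ i) :: complex ^ 2) $ k)
         = complex_of_real (s * t) * (z $ i * cnj (z $ i)) * h i i (Z s)"
        using exhaust_2[of i] by (auto simp: sum_2 Z_def axis_def scaleR_conv_of_real[where 'a = complex])
      also have "\<dots> = complex_of_real (s * t * (cmod (z $ i))\<^sup>2) * h i i (Z s)"
        unfolding complex_norm_square[symmetric] by simp
      finally show ?thesis unfolding frechet_mm by simp
    qed
    ultimately show ?thesis by (simp add: has_field_derivative_def)
  qed
  from MVT2[of 0 1 \<psi>, OF _ this] obtain s where s: "0 < s" "s < 1"
    "\<psi> 1 - \<psi> 0 = 2 * s * (cmod (z $ i))\<^sup>2 * Re (h i i (Z s))" by auto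
  have "\<psi> 1 - \<psi> 0 > 0"
    unfolding s using s h_diag_pos[of i "Z s"] ctorus_nonzero[OF z, of i] by simp
  moreover have "\<psi> 0 = 0" by (simp add: \<psi>_def mm_def Z_def)
  moreover have "Z 1 = z" by (simp add: Z_def vec_eq_iff)
  ultimately show ?thesis by (simp add: \<psi>_def mu_def)
qed

text \<open>Used to keep the preimage selected by \<open>inv mu\<close> inside the torus: on an axis
  some component of \<open>mu\<close> would vanish.\<close>

lemma mu_ctorus: "z \<in> ctorus \<Longrightarrow> mu z' = mu z \<Longrightarrow> z' \<in> ctorus"
proof -
  assume "z \<in> ctorus" "mu z' = mu z"
  then have "mu z' $ i > 0" for i using mu_pos by simp
  then have "z' $ i \<noteq> 0" for i by (metis mu_def mm_def vec_lambda_beta complex_cnj_zero mult_zero_left zero_complex.simps(1) less_irrefl)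
  then show ?thesis by (simp add: ctorus_def)
qed

section \<open>The gradient map of f and the differentiability of K\<close>

definition gr where "gr x = mu (exp_half x)"

text \<open>The Hessian of f: the real part of the metric at the real point
  \<open>exp_half x\<close>, scaled on both sides by the diagonal matrix of the exp(x_i /
  2).\<close>

definition gr_deriv where
  "gr_deriv x v = (\<chi> i. \<Sum>k\<in>UNIV. exp (x $ i / 2) * exp (x $ k / 2) * Re (h k i (exp_half x)) * v $ k)"

lemma gr_has_derivative: "(gr has_derivative gr_deriv x) (at x)"
  unfolding gr_def[abs_def]
  by (rule has_derivative_eq_rhs[OF has_derivative_compose[OF exp_half_has_derivative mu_has_derivative]])
    (simp add: gr_deriv_def fun_eq_iff vec_eq_iff exp_half_def sum_2 algebra_simps)

lemma gr_deriv_pos: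
  assumes "v \<noteq> 0"
  shows "gr_deriv x v \<bullet> v > 0"
proof -
  define a where "a i = complex_of_real (exp (x $ i / 2) * v $ i)" for i
  have "a 1 \<noteq> 0 \<or> a 2 \<noteq> 0" using assms by (auto simp: a_def vec_eq_iff forall_2)
  from h_pos[OF this, of "exp_half x"] show ?thesis
    by (simp add: gr_deriv_def inner_vec_def a_def sum_2 algebra_simps)
qed

text \<open>Strict convexity of f: the increment of the gradient, paired with y - x, is positive by
  the mean value theorem along the segment.\<close>

lemma gr_inj: "inj gr"
proof (rule injI, rule ccontr)
  fix x y assume eq: "gr x = gr y" and ne: "x \<noteq> y"
  define v where "v = y - x"
  have v: "v \<noteq> 0" using ne by (simp add: v_def)
  have "((\<lambda>t. gr (x + t *\<^sub>R v) \<bullet> v) has_real_derivative gr_deriv (x + t *\<^sub>R v) v \<bullet> v) (at t)" for t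
  proof -
    have "linear (gr_deriv (x + t *\<^sub>R v))"
      using gr_has_derivative has_derivative_linear by blast
    moreover have "((\<lambda>t. x + t *\<^sub>R v) has_derivative (\<lambda>s. s *\<^sub>R v)) (at t)"
      by (auto intro!: derivative_eq_intros)
    from has_derivative_inner_left[OF has_derivative_compose[OF this gr_has_derivative]]
    have "((\<lambda>t. gr (x + t *\<^sub>R v) \<bullet> v) has_derivative (\<lambda>s. gr_deriv (x + t *\<^sub>R v) (s *\<^sub>R v) \<bullet> v)) (at t)" .
    ultimately show ?thesis
      by (simp add: has_field_derivative_def linear_cmul mult.commute[of _ "gr_deriv _ _ \<bullet> _"])
  qed
  from MVT2[of 0 1, OF _ this] obtain t where
    "gr (x + 1 *\<^sub>R v) \<bullet> v - gr (x + 0 *\<^sub>R v) \<bullet> v = gr_deriv (x + t *\<^sub>R v) v \<bullet> v" by auto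
  then show False using gr_deriv_pos[OF v, of "x + t *\<^sub>R v"] eq by (simp add: v_def)
qed

lemma gr_log_coords: "z \<in> ctorus \<Longrightarrow> gr (log_coords z) = mu z"
  by (simp add: gr_def exp_half_log_coords mu_moduli)

text \<open>Injectivity of \<open>gr\<close> shows that the chosen preimage has the same moduli as
  z, hence lies on the same torus orbit, where the scalar curvature is constant.\<close>

lemma curvature_xi_mu:
  assumes z: "z \<in> ctorus"
  shows "curvature_xi mu F (mu z) = scalar_curvature F z"
proof -
  define z' where "z' = inv mu (mu z)"
  have mu': "mu z' = mu z" unfolding z'_def by (rule f_inv_into_f) simp
  then have z': "z' \<in> ctorus" using mu_ctorus z by blast
  have "log_coords z' = log_coords z"
    using mu' gr_log_coords z z' gr_inj by (metis injD)
  then have "moduli z' = moduli z" using exp_half_log_coords z z' by metis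
  then have "scalar_curvature F z' = scalar_curvature F z"
    using moduli_act scalar_curvature_act by metis
  then show ?thesis by (simp add: curvature_xi_def z'_def)
qed

text \<open>On the range of \<open>gr\<close>, K is the scalar curvature in logarithmic coordinates
  composed with the inverse of \<open>gr\<close>. Invariance of domain makes this range open and the
  inverse function theorem differentiates the inverse. The point is interior to the range of
  \<open>mu\<close>, so \<open>partial_within\<close> is an ordinary partial derivative
  there.\<close>

lemma curvature_xi_differentiable:
  assumes z: "z \<in> ctorus"
  shows "curvature_xi mu F differentiable (at (mu z))" "at (mu z) within range mu = at (mu z)"
proof -
  define x where "x = log_coords z"
  define s where "s = (\<lambda>x. scalar_curvature F (exp_half x))"
  have K: "curvature_xi mu F y = s (inv gr y)" if "y \<in> range gr" for y
    using that gr_inj curvature_xi_mu[OF exp_half_ctorus] by (auto simp: s_def gr_def[symmetric] inv_f_f)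
  have lin: "linear (gr_deriv x)" using gr_has_derivative has_derivative_linear by blast
  have "inj (gr_deriv x)"
    unfolding linear_injective_0[OF lin] using gr_deriv_pos by (metis inner_zero_left less_irrefl)
  then obtain A where A: "linear A" "A \<circ> gr_deriv x = id"
    using linear_injective_left_inverse[OF lin] by blast
  then have A': "gr_deriv x \<circ> A = id" using linear_inverse_left[OF lin] by blast
  have cont: "continuous_on UNIV gr"
    using gr_has_derivative has_derivative_continuous by (blast intro: continuous_at_imp_continuous_on)
  have open_range: "open (range gr)"
    using invariance_of_domain[OF cont open_UNIV gr_inj] .
  have "(inv gr has_derivative A) (at (gr x))"
    by (rule has_derivative_inverse_strong[OF open_UNIV UNIV_I cont _ gr_has_derivative A'])
      (simp add: gr_inj)
  then have d1: "inv gr differentiable (at (gr x))" using differentiableI by blast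
  have "(\<lambda>w. - L V w) differentiable (at (exp_half x))"
    using smooth_differentiable[OF smooth_uminus[OF smooth_L[OF V_smooth]]] .
  then have "(\<lambda>w. complex_of_real (scalar_curvature F w)) differentiable (at (exp_half x))"
    by (simp add: L_V)
  then have "(\<lambda>w. scalar_curvature F w) differentiable (at (exp_half x))"
    unfolding differentiable_def using has_derivative_Re by fastforce
  then have "s differentiable (at x)"
    unfolding s_def
    using differentiable_chain_at[OF differentiableI[OF exp_half_has_derivative], of "scalar_curvature F" x]
    by (simp add: o_def)
  then have "(\<lambda>y. s (inv gr y)) differentiable (at (gr x))"
    using differentiable_chain_at[OF d1, of s] by (simp add: gr_inj o_def)
  then have "curvature_xi mu F differentiable (at (gr x))"
    unfolding differentiable_def
    using has_derivative_transform_within_open[OF _ open_range] K by (metis rangeI)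
  then show "curvature_xi mu F differentiable (at (mu z))"
    using gr_log_coords[OF z] by (simp add: x_def)
  have "mu z \<in> range gr" using gr_log_coords[OF z] by (metis rangeI)
  moreover have "range gr \<subseteq> range mu" by (auto simp: gr_def)
  ultimately have "mu z \<in> interior (range mu)"
    using open_range interior_maximal by blast
  then show "at (mu z) within range mu = at (mu z)" by (rule at_within_interior)
qed

text \<open>Chain rule for L V = - K o mu on the open torus; \<open>dz\<close> of 2 Re of a complex
  linear form picks out its coefficient.\<close>

lemma dz_L_V:
  assumes z: "z \<in> ctorus"
  shows "dz k (L V) z = - (\<Sum>i\<in>UNIV. complex_of_real (partial_within (range mu) i (curvature_xi mu F) (mu z))
     * (cnj (z $ i) * h k i z))"
proof -
  define K where "K = curvature_xi mu F"
  define K' where "K' = frechet_derivative K (at (mu z))"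
  define p where "p i = partial_within (range mu) i K (mu z)" for i
  have K': "(K has_derivative K') (at (mu z))"
    using curvature_xi_differentiable(1)[OF z] by (simp add: K_def K'_def frechet_derivative_works)
  have lin: "linear K'" using K' has_derivative_linear by blast
  have p: "p i = K' (axis i 1)" for i
    using curvature_xi_differentiable(2)[OF z] by (simp add: p_def K'_def partial_within_def)
  have K'_eq: "K' v = (\<Sum>i\<in>UNIV. p i * v $ i)" for v
  proof -
    have v: "v = (\<Sum>i\<in>UNIV. v $ i *\<^sub>R axis i 1)"
      by (auto simp: vec_eq_iff sum_2 axis_def forall_2)
    have "K' v = (\<Sum>i\<in>UNIV. v $ i *\<^sub>R K' (axis i 1))"
      by (subst v) (simp add: linear_sum[OF lin] linear_cmul[OF lin])
    then show ?thesis by (simp add: p mult.commute)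
  qed
  have "((\<lambda>w. K (mu w)) has_derivative (\<lambda>v. K' (\<chi> i. 2 * Re (\<Sum>k\<in>UNIV. cnj (z $ i) * h k i z * v $ k)))) (at z)"
    by (rule has_derivative_compose[OF mu_has_derivative K'])
  then have "((\<lambda>w. - complex_of_real (K (mu w))) has_derivative
     (\<lambda>v. - complex_of_real (K' (\<chi> i. 2 * Re (\<Sum>k\<in>UNIV. cnj (z $ i) * h k i z * v $ k))))) (at z)"
    by (intro has_derivative_minus has_derivative_of_real)
  then have d: "(L V has_derivative
     (\<lambda>v. - complex_of_real (K' (\<chi> i. 2 * Re (\<Sum>k\<in>UNIV. cnj (z $ i) * h k i z * v $ k))))) (at z)"
    by (rule has_derivative_transform_within_open[OF _ open_ctorus z])
      (simp add: L_V K_def curvature_xi_mu)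
  have a: "(\<Sum>j\<in>UNIV. c j * (axis k y :: complex ^ 2) $ j) = c k * y" for c y
    using exhaust_2[of k] by (auto simp: sum_2 axis_def)
  show ?thesis
    unfolding dz_eq[OF d] K'_eq a K_def[symmetric] p_def[symmetric]
    by (simp add: sum_2 complex_eq_iff field_simps)
qed

end

subsection \<open>The combined estimate\<close>

context kahler begin

lemma trT_pos: "trT F z > 0"
proof -
  have "Re (G 1 1 z) = Re (h 2 2 z) / Re (W z)" "Re (G 2 2 z) = Re (h 1 1 z) / Re (W z)"
    unfolding G_explicit using W_real[of z] by (metis Re_divide_of_real field_class.field_divide_inverse)+
  then have "Re (G 1 1 z) > 0" "Re (G 2 2 z) > 0" using h_diag_pos W_pos by simp_all
  moreover have "trT F z = Re (G 1 1 z) + Re (G 2 2 z)" by (simp add: trT_def inv_hess_eq sum_2)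
  ultimately show ?thesis by simp
qed

text \<open>In dimension two tr h = det h * tr h^{-1}, and the other diagonal entry is
  positive.\<close>

lemma h_diag_le: "Re (h i i z) \<le> detW F z * trT F z"
proof -
  have "complex_of_real (detW F z * trT F z) = W z * (G 1 1 z + G 2 2 z)"
    using trT_eq[of z] W_real[of z] by (simp add: sum_2 detW_eq)
  also have "\<dots> = h 1 1 z + h 2 2 z"
    unfolding G_explicit using W_nonzero[of z] by (simp add: field_simps)
  finally have "detW F z * trT F z = Re (h 1 1 z) + Re (h 2 2 z)"
    by (metis Re_complex_of_real plus_complex.simps(1))
  then show ?thesis using h_diag_pos[of 1 z] h_diag_pos[of 2 z] exhaust_2[of i] by auto
qed

text \<open>Cauchy-Schwarz gives |V_i|^2 \<le> h_ii \<Psi>, and \<open>h_diag_le\<close> bounds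
  h_ii.\<close>

lemma dz_V_bound: "(cmod (dz i V z))\<^sup>2 \<le> Psi F z * detW F z * trT F z"
proof -
  \<comment> \<open>The defect in Cauchy-Schwarz: h_ii \<Psi> W exceeds W |V_i|^2 by exactly
    |q|^2.\<close>
  define q where "q = (if i = 1 then h 2 1 z * dz 1 V z - h 1 1 z * dz 2 V z
     else h 1 2 z * dz 2 V z - h 2 2 z * dz 1 V z)"
  have "h i i z * ip dV dV z * W z = W z * (dz i V z * cnj (dz i V z)) + q * cnj q"
  proof -
    have e: "ip dV dV z * W z = h 2 2 z * dz 1 V z * cnj (dz 1 V z) - h 2 1 z * dz 1 V z * cnj (dz 2 V z)
       - h 1 2 z * dz 2 V z * cnj (dz 1 V z) + h 1 1 z * dz 2 V z * cnj (dz 2 V z)"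
      using W_nonzero[of z] by (simp add: ip_def sum_2 dV_def G_explicit field_simps)
    show ?thesis
      using exhaust_2[of i] unfolding q_def mult.assoc[of "h i i z"] e
      by (auto simp: W_def cnj_h algebra_simps)
  qed
  also have "W z * (dz i V z * cnj (dz i V z)) + q * cnj q
     = complex_of_real (detW F z * (cmod (dz i V z))\<^sup>2 + (cmod q)\<^sup>2)"
    unfolding complex_norm_square[symmetric] using W_real[of z] by (simp add: detW_eq)
  also have "h i i z * ip dV dV z * W z = complex_of_real (Re (h i i z) * Psi F z * detW F z)"
    unfolding Psi_eq using h_diag_real[of i z] W_real[of z] by (simp add: detW_eq)
  finally have "Re (h i i z) * Psi F z * detW F z = detW F z * (cmod (dz i V z))\<^sup>2 + (cmod q)\<^sup>2"
    using of_real_eq_iff by blast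
  then have "detW F z * (cmod (dz i V z))\<^sup>2 \<le> detW F z * (Re (h i i z) * Psi F z)"
    by (simp add: mult_ac)
  then have "(cmod (dz i V z))\<^sup>2 \<le> Re (h i i z) * Psi F z"
    using detW_pos by simp
  also have "\<dots> \<le> (detW F z * trT F z) * Psi F z"
    by (intro mult_right_mono h_diag_le Psi_nonneg)
  finally show ?thesis by (simp add: mult_ac)
qed

lemma smooth_P: "smooth_complex (\<lambda>w. complex_of_real (P_fun \<kappa> \<alpha> F w))"
  unfolding P_fun_eq by (intro smooth_mult smooth_exp gP_smooth ip_smooth dV_smooth)

lemma smooth_Q: "smooth_complex (\<lambda>w. complex_of_real (Q_fun N1 A F w))"
  unfolding Q_fun_eq by (intro smooth_sum smooth_mult smooth_exp gQ_smooth ip_smooth cst_smooth)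

lemma Box_F: "Box F F w = 2"
proof -
  have "L Fc w = (\<Sum>k\<in>UNIV. \<Sum>l\<in>UNIV. G k l w * h k l w)" by (simp add: L_def h_def)
  also have "\<dots> = 2" by (simp add: G_h)
  finally show ?thesis by (simp add: Box_eq flip: Fc_def)
qed

lemma Box_sum:
  fixes c :: real
  assumes "smooth_complex (\<lambda>w. complex_of_real (p w))" "smooth_complex (\<lambda>w. complex_of_real (q w))"
  shows "Box F (\<lambda>w. p w + q w + c * F w) w = Box F p w + Box F q w + 2 * c"
proof -
  have "L (\<lambda>w. complex_of_real (p w + q w + c * F w)) w
     = L (\<lambda>w. complex_of_real (p w)) w + L (\<lambda>w. complex_of_real (q w)) w + complex_of_real c * L Fc w"
    unfolding L_def Fc_def
    using assms Fc_smooth[unfolded Fc_def]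
    by (simp add: dz_add dzbar_add dz_mult dzbar_mult smooth_add smooth_mult smooth_dz smooth_dzbar sum_2 algebra_simps)
  then show ?thesis
    using Box_F[of w] by (simp add: Box_eq Fc_def)
qed

lemma Box_continuous:
  assumes "smooth_complex (\<lambda>w. complex_of_real (p w))"
  shows "continuous_on UNIV (Box F p)"
  unfolding Box_eq[abs_def] by (intro continuous_on_Re smooth_continuous smooth_L assms)

end

text \<open>The metric in \<open>dz_L_V\<close> cancels the inverse metric in \<open>ip\<close>. The
  remaining sum has no metric factor and is bounded termwise by the partial derivatives of K, by |z|
  and by \<open>dz_V_bound\<close>.\<close>

lemma (in toric_kahler) gradient_pairing_bound:
  assumes z: "z \<in> ctorus" and nz: "norm z \<le> N"
    and K: "(\<Sum>i\<in>UNIV. \<bar>partial_within (range mu) i (curvature_xi mu F) (mu z)\<bar>) \<le> N"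
  shows "\<bar>Re (ip (\<lambda>i. dz i (L V)) dV z)\<bar> \<le> N\<^sup>2 * sqrt (Psi F z * detW F z * trT F z)"
proof -
  define p where "p i = partial_within (range mu) i (curvature_xi mu F) (mu z)" for i
  define B where "B = sqrt (Psi F z * detW F z * trT F z)"
  have hG: "h 1 1 z * G 1 1 z + h 2 1 z * G 2 1 z = 1" "h 1 1 z * G 1 2 z + h 2 1 z * G 2 2 z = 0"
    "h 1 2 z * G 1 1 z + h 2 2 z * G 2 1 z = 0" "h 1 2 z * G 1 2 z + h 2 2 z * G 2 2 z = 1"
    using h_G[of 1 z 1] h_G[of 1 z 2] h_G[of 2 z 1] h_G[of 2 z 2] by (simp_all add: sum_2)
  have "ip (\<lambda>i. dz i (L V)) dV z = - (\<Sum>m\<in>UNIV. \<Sum>j\<in>UNIV. (\<Sum>i\<in>UNIV. h i m z * G i j z) *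
      (complex_of_real (p m) * cnj (z $ m) * cnj (dz j V z)))"
    unfolding ip_def dz_L_V[OF z] p_def[symmetric] dV_def by (simp add: sum_2 algebra_simps)
  also have "\<dots> = - (\<Sum>m\<in>UNIV. complex_of_real (p m) * cnj (z $ m) * cnj (dz m V z))"
    by (simp add: hG sum_2)
  finally have e: "ip (\<lambda>i. dz i (L V)) dV z = - (\<Sum>m\<in>UNIV. complex_of_real (p m) * cnj (z $ m) * cnj (dz m V z))" .
  have "\<bar>Re (ip (\<lambda>i. dz i (L V)) dV z)\<bar> \<le> cmod (\<Sum>m\<in>UNIV. complex_of_real (p m) * cnj (z $ m) * cnj (dz m V z))"
    using abs_Re_le_cmod[of "ip (\<lambda>i. dz i (L V)) dV z"] unfolding e norm_minus_cancel .
  also have "\<dots> \<le> (\<Sum>m\<in>UNIV. \<bar>p m\<bar> * (N * B))"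
  proof (rule sum_norm_le)
    fix m :: 2
    have "cmod (z $ m) \<le> N" using nz Finite_Cartesian_Product.norm_nth_le[of z m] by linarith
    moreover have "cmod (dz m V z) \<le> B"
      unfolding B_def using dz_V_bound by (simp add: real_le_rsqrt)
    ultimately have "cmod (z $ m) * cmod (dz m V z) \<le> N * B"
      by (intro mult_mono) (auto intro: order_trans[OF norm_ge_zero])
    then show "cmod (complex_of_real (p m) * cnj (z $ m) * cnj (dz m V z)) \<le> \<bar>p m\<bar> * (N * B)"
      by (simp add: norm_mult mult.assoc mult_left_mono)
  qed
  also have "\<dots> = (\<Sum>m\<in>UNIV. \<bar>p m\<bar>) * (N * B)" by (simp add: sum_distrib_right)
  also have "\<dots> \<le> N * (N * B)"
  proof (rule mult_right_mono)
    show "(\<Sum>m\<in>UNIV. \<bar>p m\<bar>) \<le> N" using K by (simp add: p_def)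
    have "N \<ge> 0" using nz norm_ge_zero[of z] by linarith
    moreover have "B \<ge> 0" unfolding B_def using Psi_nonneg detW_pos[of z] trT_pos[of z] by simp
    ultimately show "0 \<le> N * B" by simp
  qed
  finally show ?thesis by (simp add: B_def power2_eq_square mult.assoc)
qed

section \<open>Inequalities between real numbers\<close>

lemma quadratic_absorb:
  fixes a b c C :: real
  assumes "c > 0" "a \<ge> 0" "b \<ge> 0"
  shows "c * (a\<^sup>2 + b\<^sup>2) - C * (a + b) \<ge> c / 4 * (a + b)\<^sup>2 - C\<^sup>2 / c"
proof -
  define y where "y = a + b"
  have "a\<^sup>2 + b\<^sup>2 \<ge> y\<^sup>2 / 2"
    using zero_le_power2[of "a - b"] by (simp add: y_def power2_eq_square algebra_simps)
  then have "c * (a\<^sup>2 + b\<^sup>2) \<ge> c * (y\<^sup>2 / 2)" using assms(1) by (intro mult_left_mono) auto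
  moreover have "c * (y\<^sup>2 / 2) - C * y - (c / 4 * y\<^sup>2 - C\<^sup>2 / c) = c / 4 * (y - 2 * C / c)\<^sup>2"
    using assms(1) by (simp add: power2_eq_square field_simps)
  moreover have "c / 4 * (y - 2 * C / c)\<^sup>2 \<ge> 0" using assms(1) by simp
  ultimately show ?thesis unfolding y_def by linarith
qed

text \<open>The arithmetic at a single point. Here x is W^(1/3), r bounds W^(1/6), e1 and e2 are the
  exponential weights, R is |ddbar V|^2, \<rho> and \<rho>T are the Ricci terms on \<partial>V and
  on dz_1, dz_2, and D is the gradient pairing.\<close>

lemma combined_estimate:
  fixes N w \<kappa> x e1 e2 \<epsilon> \<Psi> T R \<rho> \<rho>T S D BP BQ c1 C3 :: real
  assumes N: "N > 0" and w: "0 < w" "w \<le> N" and x: "x > 0" "\<kappa> > 0" "\<kappa> * x \<le> 1/4"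
    and sx: "sqrt w \<le> x * r" and r: "r > 0"
    and e1: "1 \<le> e1" "e1 \<le> 2" and e2: "\<epsilon> \<le> e2" "e2 \<le> 1" and eps: "\<epsilon> > 0"
    and pos: "\<Psi> \<ge> 0" "T > 0" and S: "\<bar>S\<bar> \<le> N"
    and R: "R \<ge> 0" "R + 2 * (4/9 * \<kappa> * x) * \<rho> + (4/9 * \<kappa> * x)\<^sup>2 * \<Psi>\<^sup>2 \<ge> 0" "R / 4 - \<rho>T + T\<^sup>2 \<ge> 0"
    and D: "\<bar>D\<bar> \<le> N\<^sup>2 * sqrt (\<Psi> * w * T)"
    and BP: "BP \<ge> e1 * sqrt w * (R + 2 * \<kappa> * (1/3) * x * \<rho> + 2 * D
       + (- (\<kappa> * (1/3) * x + 1/2) * S + \<kappa> * (1/3)\<^sup>2 * x * \<Psi>) * \<Psi>)"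
    and BQ: "BQ \<ge> e2 * sqrt w * (100 * T\<^sup>2 - S / 2 * T - \<rho>T)"
  defines "p \<equiv> e1 * sqrt w * \<Psi>" and "q \<equiv> e2 * sqrt w * T"
  shows "BP + BQ \<ge> min (\<kappa> / (27 * r)) (99 / sqrt N) * (p\<^sup>2 + q\<^sup>2)
     - (N + 2 * sqrt N * N\<^sup>2 / sqrt \<epsilon>) * (p + q)"
proof -
  define sw where "sw = sqrt w"
  have sw: "sw > 0" "sw * sw = w" "sw \<le> sqrt N" using w by (simp_all add: sw_def)
  have e2': "e2 > 0" using e2 eps by linarith
  have pq: "p \<ge> 0" "q > 0" using pos sw e1 e2' by (simp_all add: p_def q_def flip: sw_def)
  \<comment> \<open>Three quarters of R complete the square; 3/4 * 2 d = 2/3 \<kappa> x dictates d =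
    4/9 \<kappa> x. As \<kappa> x \<le> 1/4, the loss is at most \<kappa> x \<Psi>^2 / 27, a third
    of the good term \<kappa> x \<Psi>^2 / 9. The remaining R / 4 is kept for Q.\<close>
  have 1: "R + 2 * \<kappa> * (1/3) * x * \<rho> \<ge> R / 4 - \<kappa> * x * \<Psi>\<^sup>2 / 27"
  proof -
    have "0 \<le> 3/4 * (R + 2 * (4/9 * \<kappa> * x) * \<rho> + (4/9 * \<kappa> * x)\<^sup>2 * \<Psi>\<^sup>2)"
      using R(2) by (intro mult_nonneg_nonneg) auto
    also have "\<dots> = 3/4 * R + 2/3 * \<kappa> * x * \<rho> + 4/27 * (\<kappa> * x) * (\<kappa> * x) * \<Psi>\<^sup>2"
      by (simp add: power2_eq_square algebra_simps)
    finally have "3/4 * R + 2/3 * \<kappa> * x * \<rho> \<ge> - (4/27 * (\<kappa> * x) * (\<kappa> * x) * \<Psi>\<^sup>2)"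
      by linarith
    moreover have "(\<kappa> * x) * ((\<kappa> * x) * \<Psi>\<^sup>2) \<le> 1/4 * ((\<kappa> * x) * \<Psi>\<^sup>2)"
      using x by (intro mult_right_mono) auto
    ultimately show ?thesis by (simp add: algebra_simps)
  qed
  have 2: "(\<kappa> * (1/3) * x + 1/2) * S * \<Psi> \<le> N * \<Psi>"
  proof -
    have "(\<kappa> * (1/3) * x + 1/2) * S \<le> (\<kappa> * (1/3) * x + 1/2) * N"
      using S x by (intro mult_left_mono) auto
    also have "\<dots> \<le> 1 * N" using x N by (intro mult_right_mono) auto
    finally show ?thesis using pos by (simp add: mult_right_mono)
  qed
  have "R + 2 * \<kappa> * (1/3) * x * \<rho> + 2 * D + (- (\<kappa> * (1/3) * x + 1/2) * S + \<kappa> * (1/3)\<^sup>2 * x * \<Psi>) * \<Psi>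
     \<ge> R / 4 + 2/27 * \<kappa> * x * \<Psi>\<^sup>2 - 2 * \<bar>D\<bar> - N * \<Psi>"
    using 1 2 by (simp add: power2_eq_square algebra_simps)
  then have "e1 * sw * (R + 2 * \<kappa> * (1/3) * x * \<rho> + 2 * D + (- (\<kappa> * (1/3) * x + 1/2) * S + \<kappa> * (1/3)\<^sup>2 * x * \<Psi>) * \<Psi>)
     \<ge> e1 * sw * (R / 4 + 2/27 * \<kappa> * x * \<Psi>\<^sup>2 - 2 * \<bar>D\<bar> - N * \<Psi>)"
    using e1 sw by (intro mult_left_mono) auto
  with BP have P1: "BP \<ge> e1 * sw * (R / 4) + 2/27 * \<kappa> * x * (e1 * sw * \<Psi>\<^sup>2) - 2 * (e1 * sw) * \<bar>D\<bar> - N * p"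
    by (simp add: sw_def p_def algebra_simps)
  \<comment> \<open>The good term is linear in the weight e1 sqrt w and p^2 is quadratic; the
    missing factor is at most 2 x r.\<close>
  have P2: "2/27 * \<kappa> * x * (e1 * sw * \<Psi>\<^sup>2) \<ge> \<kappa> / (27 * r) * p\<^sup>2"
  proof -
    have "e1 * sw \<le> 2 * (x * r)" using e1 sx sw by (intro mult_mono) (auto simp: sw_def)
    then have "(e1 * sw * \<Psi>\<^sup>2) * (e1 * sw) \<le> (e1 * sw * \<Psi>\<^sup>2) * (2 * (x * r))"
      using e1 sw by (intro mult_left_mono) auto
    then have "p\<^sup>2 \<le> (e1 * sw * \<Psi>\<^sup>2) * (2 * (x * r))"
      by (simp add: p_def sw_def power2_eq_square mult_ac)
    then have "\<kappa> / (27 * r) * p\<^sup>2 \<le> \<kappa> / (27 * r) * ((e1 * sw * \<Psi>\<^sup>2) * (2 * (x * r)))"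
      using x r by (intro mult_left_mono) auto
    also have "\<dots> = 2/27 * \<kappa> * x * (e1 * sw * \<Psi>\<^sup>2)" using r by (simp add: field_simps)
    finally show ?thesis .
  qed
  \<comment> \<open>Since p q = e1 e2 w \<Psi> T with e1 e2 \<ge> \<epsilon>, the bound on D is a
    multiple of sqrt(p q), and the inequality of the means makes it linear in p + q.\<close>
  have P3: "2 * (e1 * sw) * \<bar>D\<bar> \<le> 2 * sqrt N * N\<^sup>2 / sqrt \<epsilon> * (p + q)"
  proof -
    have "\<epsilon> \<le> e1 * e2" using e1 e2 eps mult_mono[of 1 e1 \<epsilon> e2] by simp
    then have "(\<epsilon> * 4) * (\<Psi> * w * T) \<le> (e1 * e2 * 4) * (\<Psi> * w * T)"
      using pos w by (intro mult_right_mono) auto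
    also have "\<dots> = 4 * p * q"
      using w by (simp add: p_def q_def mult_ac)
    also have "\<dots> \<le> (p + q)\<^sup>2"
      using zero_le_power2[of "p - q"] by (simp add: power2_eq_square algebra_simps)
    finally have "sqrt ((\<epsilon> * 4) * (\<Psi> * w * T)) \<le> p + q"
      using pq by (intro real_le_lsqrt) auto
    then have "2 * sqrt \<epsilon> * sqrt (\<Psi> * w * T) \<le> p + q"
      by (simp add: real_sqrt_mult)
    then have s: "sqrt (\<Psi> * w * T) \<le> (p + q) / (2 * sqrt \<epsilon>)"
      using eps by (simp add: field_simps)
    have "e1 * sw \<le> 2 * sqrt N" using e1 sw by (intro mult_mono) auto
    then have "(e1 * sw) * \<bar>D\<bar> \<le> (2 * sqrt N) * (N\<^sup>2 * ((p + q) / (2 * sqrt \<epsilon>)))"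
      using D s e1 sw N by (intro mult_mono order_trans[OF D] mult_left_mono) auto
    then show ?thesis using eps by (simp add: field_simps)
  qed
  have "S / 2 * T \<le> N * T" using S pos by (intro mult_right_mono) auto
  then have "100 * T\<^sup>2 - S / 2 * T - \<rho>T \<ge> 99 * T\<^sup>2 - N * T - R / 4" using R(3) by simp
  then have "e2 * sw * (100 * T\<^sup>2 - S / 2 * T - \<rho>T) \<ge> e2 * sw * (99 * T\<^sup>2 - N * T - R / 4)"
    using e2' sw by (intro mult_left_mono) auto
  with BQ have Q1: "BQ \<ge> 99 * (e2 * sw * T\<^sup>2) - N * q - e2 * sw * (R / 4)"
    by (simp add: sw_def q_def algebra_simps)
  have Q2: "99 * (e2 * sw * T\<^sup>2) \<ge> 99 / sqrt N * q\<^sup>2"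
  proof -
    have "e2 * sw \<le> 1 * sqrt N" using e2 e2' sw by (intro mult_mono) auto
    then have "(e2 * sw * T\<^sup>2) * (e2 * sw) \<le> (e2 * sw * T\<^sup>2) * sqrt N"
      using e2' sw by (intro mult_left_mono) auto
    then have "q\<^sup>2 \<le> (e2 * sw * T\<^sup>2) * sqrt N" by (simp add: q_def sw_def power2_eq_square mult_ac)
    then show ?thesis using N by (simp add: field_simps)
  qed
  \<comment> \<open>The absorption: because e2 \<le> 1 \<le> e1, the quarter of R kept from P covers
    the quarter spent by Q.\<close>
  have "e2 * sw * (R / 4) \<le> e1 * sw * (R / 4)"
    using e1 e2 sw R(1) by (intro mult_right_mono) auto
  with P1 P2 P3 Q1 Q2 have "BP + BQ \<ge> \<kappa> / (27 * r) * p\<^sup>2 + 99 / sqrt N * q\<^sup>2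
      - (N + 2 * sqrt N * N\<^sup>2 / sqrt \<epsilon>) * (p + q)"
    by (simp add: algebra_simps add_divide_distrib)
  moreover have "\<kappa> / (27 * r) * p\<^sup>2 \<ge> min (\<kappa> / (27 * r)) (99 / sqrt N) * p\<^sup>2"
    "99 / sqrt N * q\<^sup>2 \<ge> min (\<kappa> / (27 * r)) (99 / sqrt N) * q\<^sup>2"
    by (intro mult_right_mono; simp)+
  ultimately show ?thesis by (simp add: algebra_simps)
qed

lemma (in toric_kahler) Box_P_Q_lower_bound:
  fixes N :: real
  assumes N: "N > 0" and z: "z \<in> ctorus" and nz: "norm z \<le> N" and W: "detW F z \<le> N"
    and K: "\<bar>curvature_xi mu F (mu z)\<bar>
      + (\<Sum>i\<in>UNIV. \<bar>partial_within (range mu) i (curvature_xi mu F) (mu z)\<bar>) \<le> N"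
  defines "\<kappa> \<equiv> 1 / (4 * N powr (1/3))" and "\<epsilon> \<equiv> exp (- 100 * (N\<^sup>2 + 1))"
  defines "p \<equiv> P_fun \<kappa> (1/3) F" and "q \<equiv> Q_fun 100 (N\<^sup>2 + 1) F"
  shows "Box F p z + Box F q z \<ge> min (\<kappa> / (27 * N powr (1/6))) (99 / sqrt N) * ((p z)\<^sup>2 + (q z)\<^sup>2)
     - (N + 2 * sqrt N * N\<^sup>2 / sqrt \<epsilon>) * (p z + q z)"
proof -
  define x where "x = detW F z powr (1/3)"
  define e1 where "e1 = exp (\<kappa> * x)"
  define e2 where "e2 = exp (100 * ((norm z)\<^sup>2 - (N\<^sup>2 + 1)))"
  note w = detW_pos[of z]
  have x: "x > 0" using w by (simp add: x_def)
  have \<kappa>: "\<kappa> > 0" using N by (simp add: \<kappa>_def)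
  have "x \<le> N powr (1/3)" unfolding x_def using w W by (intro powr_mono2) auto
  then have kx: "\<kappa> * x \<le> 1/4" using N by (simp add: \<kappa>_def field_simps)
  \<comment> \<open>The splitting 1/2 = 1/3 + 1/6 is the origin of r = N^(1/6).\<close>
  have "sqrt (detW F z) = x * detW F z powr (1/6)"
    unfolding x_def powr_add[symmetric] using w by (simp add: powr_half_sqrt)
  also have "\<dots> \<le> x * N powr (1/6)"
    using x w W by (intro mult_left_mono powr_mono2) auto
  finally have sx: "sqrt (detW F z) \<le> x * N powr (1/6)" .
  have e1: "1 \<le> e1" "e1 \<le> 2"
  proof -
    show "1 \<le> e1" using x \<kappa> by (simp add: e1_def)
    have "e1 \<le> exp (1/4)" using kx by (simp add: e1_def)
    also have "\<dots> \<le> 1 + 1/4 + (1/4)\<^sup>2" by (rule exp_bound) auto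
    finally show "e1 \<le> 2" by (simp add: power2_eq_square)
  qed
  \<comment> \<open>The choice A = N^2 + 1 makes the exponent negative; |z|^2 \<ge> 0 gives the
    lower bound \<epsilon>.\<close>
  have "(norm z)\<^sup>2 \<le> N\<^sup>2" using nz by (simp add: power_mono)
  then have e2: "\<epsilon> \<le> e2" "e2 \<le> 1" by (simp_all add: e2_def \<epsilon>_def)
  have S: "\<bar>scalar_curvature F z\<bar> \<le> N"
    and Kd: "(\<Sum>i\<in>UNIV. \<bar>partial_within (range mu) i (curvature_xi mu F) (mu z)\<bar>) \<le> N"
    using K[unfolded curvature_xi_mu[OF z]]
      sum_nonneg[of UNIV "\<lambda>i. \<bar>partial_within (range mu) i (curvature_xi mu F) (mu z)\<bar>", OF abs_ge_zero]
    by linarith+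
  have Rpos: "Ric2 z \<ge> 0" using Ric2_rho_dV[of z 0] by simp
  have pq: "p z = e1 * sqrt (detW F z) * Psi F z" "q z = e2 * sqrt (detW F z) * trT F z"
    by (simp_all add: p_def q_def P_fun_def Q_fun_def e1_def e2_def x_def)
  show ?thesis
    unfolding pq
  proof (rule combined_estimate[OF N w W x \<kappa> kx sx _ e1 e2 _ Psi_nonneg trT_pos S Rpos Ric2_rho_dV Ric2_rho_cst
        gradient_pairing_bound[OF z nz Kd]])
    show "e1 * sqrt (detW F z) * (Ric2 z + 2 * \<kappa> * (1/3) * x * rho dV z + 2 * Re (ip (\<lambda>i. dz i (L V)) dV z)
       + (- (\<kappa> * (1/3) * x + 1/2) * scalar_curvature F z + \<kappa> * (1/3)\<^sup>2 * x * Psi F z) * Psi F z) \<le> Box F p z"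
      unfolding e1_def x_def p_def by (rule Box_P)
    show "e2 * sqrt (detW F z) * (100 * (trT F z)\<^sup>2 - scalar_curvature F z / 2 * trT F z - (\<Sum>m\<in>UNIV. rho (cst m) z)) \<le> Box F q z"
      unfolding e2_def q_def by (rule Box_Q)
  qed (use N in \<open>simp_all add: \<epsilon>_def\<close>)
qed

theorem lemma5p4:
  fixes N2 :: real
  assumes "N2 > 0"
  shows "\<exists>C7 > 0. \<exists>C8 > 0.
    \<forall>(d :: nat) (\<nu> :: nat \<Rightarrow> int ^ 2) (lam :: nat \<Rightarrow> real) (\<theta> :: real ^ 2)
      (\<phi> :: real ^ 2 \<Rightarrow> real ^ 2) (u :: real ^ 2 \<Rightarrow> real) (f :: real ^ 2 \<Rightarrow> real)
      (F :: complex ^ 2 \<Rightarrow> real) (\<Omega> :: (complex ^ 2) set)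
      (\<tau> :: complex ^ 2 \<Rightarrow> real ^ 2) (K :: real ^ 2 \<Rightarrow> real)
      (A :: real) (N1 :: real) (\<alpha> :: real) (\<kappa> :: real)
      (P :: complex ^ 2 \<Rightarrow> real) (Q :: complex ^ 2 \<Rightarrow> real).
      delzant d \<nu> lam \<longrightarrow>
      \<theta> extreme_point_of closure (open_polygon d \<nu> lam) \<longrightarrow>
      adapted_coordinates d \<nu> lam \<theta> \<phi> \<longrightarrow>
      u \<in> symplectic_potentials d \<nu> lam \<longrightarrow>
      f = legendre (\<phi> ` open_polygon d \<nu> lam) (u \<circ> inv \<phi>) \<longrightarrow>
      chart_potential f F \<longrightarrow>
      open \<Omega> \<longrightarrow> 0 \<in> \<Omega> \<longrightarrow>
      \<tau> = moment_map f \<longrightarrow>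
      K = curvature_xi \<tau> F \<longrightarrow>
      (\<forall>\<xi> \<in> \<tau> ` closure \<Omega>.
         \<bar>K \<xi>\<bar> + (\<Sum>i\<in>UNIV. \<bar>partial_within (range \<tau>) i K \<xi>\<bar>) \<le> N2) \<longrightarrow>
      (\<forall>z \<in> closure \<Omega>. detW F z \<le> N2) \<longrightarrow>
      (\<forall>z \<in> closure \<Omega>. norm z \<le> N2) \<longrightarrow>
      A = N2\<^sup>2 + 1 \<longrightarrow> N1 = 100 \<longrightarrow> \<alpha> = 1 / 3 \<longrightarrow> \<kappa> = 1 / (4 * N2 powr (1 / 3)) \<longrightarrow>
      P = P_fun \<kappa> \<alpha> F \<longrightarrow>
      Q = Q_fun N1 A F \<longrightarrow>
      (\<forall>z \<in> \<Omega>. Box F (\<lambda>w. P w + Q w + C7 * F w) z \<ge> C8 * (P z + Q z)\<^sup>2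
              \<and> C8 * (P z + Q z)\<^sup>2 > 0)"
proof -
  define \<kappa>\<^sub>0 where "\<kappa>\<^sub>0 = 1 / (4 * N2 powr (1/3))"
  \<comment> \<open>The numbers c and C are the coefficients in \<open>Box_P_Q_lower_bound\<close>.
    They involve N2 alone, so the witnesses can be fixed before all geometric data.\<close>
  define c where "c = min (\<kappa>\<^sub>0 / (27 * N2 powr (1/6))) (99 / sqrt N2)"
  define C where "C = N2 + 2 * sqrt N2 * N2\<^sup>2 / sqrt (exp (- 100 * (N2\<^sup>2 + 1)))"
  have c: "c > 0" using assms by (simp add: c_def \<kappa>\<^sub>0_def)
  have "C > 0" using assms by (simp add: C_def add_pos_pos)
  then have C7: "C\<^sup>2 / c > 0" using c by simp
  have C8: "c / 4 > 0" using c by simp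
  show ?thesis
  \<comment> \<open>\<open>quadratic_absorb\<close> leaves the deficit C^2 / c and the coefficient c
    / 4. By \<open>Box_F\<close> the summand with this C7 contributes 2 C^2 / c, more than the
    deficit.\<close>
  proof (rule exI[of _ "C\<^sup>2 / c"], rule conjI[OF C7], rule exI[of _ "c / 4"], rule conjI[OF C8], intro allI impI ballI conjI)
    fix d \<nu> lam \<theta> \<phi> u f F \<Omega> \<tau> K A N1 \<alpha> \<kappa> P Q z
    assume f: "chart_potential f F" and \<Omega>: "open \<Omega>" and \<tau>: "\<tau> = moment_map f" and K: "K = curvature_xi \<tau> F"
      and KN: "\<forall>\<xi>\<in>\<tau> ` closure \<Omega>. \<bar>K \<xi>\<bar> + (\<Sum>i\<in>UNIV. \<bar>partial_within (range \<tau>) i K \<xi>\<bar>) \<le> N2"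
      and WN: "\<forall>z\<in>closure \<Omega>. detW F z \<le> N2" and zN: "\<forall>z\<in>closure \<Omega>. norm z \<le> N2"
      and par: "A = N2\<^sup>2 + 1" "N1 = 100" "\<alpha> = 1 / 3" "\<kappa> = 1 / (4 * N2 powr (1 / 3))"
      and P: "P = P_fun \<kappa> \<alpha> F" and Q: "Q = Q_fun N1 A F" and z: "z \<in> \<Omega>"
    interpret toric_kahler F f
      using f by unfold_locales (auto simp: chart_potential_def)
    have \<tau>: "\<tau> = mu" using \<tau> moment_map_eq by auto
    have smP: "smooth_complex (\<lambda>w. complex_of_real (P w))" and smQ: "smooth_complex (\<lambda>w. complex_of_real (Q w))"
      unfolding P Q by (rule smooth_P smooth_Q)+
    have Pnn: "P w \<ge> 0" and Qpos: "Q w > 0" for w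
      unfolding P Q P_fun_def Q_fun_def using Psi_nonneg[of w] trT_pos[of w] detW_pos[of w] by simp_all
    have on_torus: "c / 4 * (P w + Q w)\<^sup>2 \<le> Box F P w + Box F Q w + 2 * (C\<^sup>2 / c)" if w: "w \<in> \<Omega> \<inter> ctorus" for w
    proof -
      have cl: "w \<in> closure \<Omega>" using w closure_subset by blast
      have "c * ((P w)\<^sup>2 + (Q w)\<^sup>2) - C * (P w + Q w) \<le> Box F P w + Box F Q w"
        unfolding c_def C_def \<kappa>\<^sub>0_def P Q par
        by (rule Box_P_Q_lower_bound[OF assms]) (use w cl zN WN KN K \<tau> in auto)
      moreover have "c * ((P w)\<^sup>2 + (Q w)\<^sup>2) - C * (P w + Q w) \<ge> c / 4 * (P w + Q w)\<^sup>2 - C\<^sup>2 / c"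
        using Pnn Qpos[of w] by (intro quadratic_absorb c) auto
      ultimately show ?thesis using C7 by linarith
    qed
    have contPQ: "continuous_on UNIV P" "continuous_on UNIV Q"
      using continuous_on_Re[OF smooth_continuous[OF smP]] continuous_on_Re[OF smooth_continuous[OF smQ]] by simp_all
    have "closed {w. c / 4 * (P w + Q w)\<^sup>2 \<le> Box F P w + Box F Q w + 2 * (C\<^sup>2 / c)}"
      by (intro closed_Collect_le continuous_intros contPQ Box_continuous smP smQ)
    then have "closure (\<Omega> \<inter> ctorus) \<subseteq> {w. c / 4 * (P w + Q w)\<^sup>2 \<le> Box F P w + Box F Q w + 2 * (C\<^sup>2 / c)}"
      using on_torus by (intro closure_minimal) auto
    \<comment> \<open>Openness of \<Omega> is what makes its intersection with the dense torus dense
      in it.\<close>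
    moreover have "z \<in> closure (\<Omega> \<inter> ctorus)"
      using open_Int_closure_subset[OF \<Omega>, of ctorus] z closure_ctorus by blast
    ultimately show "Box F (\<lambda>w. P w + Q w + C\<^sup>2 / c * F w) z \<ge> c / 4 * (P z + Q z)\<^sup>2"
      unfolding Box_sum[OF smP smQ] by blast
    show "c / 4 * (P z + Q z)\<^sup>2 > 0"
      using c Pnn[of z] Qpos[of z] by (simp add: add_nonneg_pos)
  qed
qed

end
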